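(* Let $A,B>0$. There exists a constant $C=C(A,B)>0$ such that the following holds. Let $N\ge 200\sqrt{B/A}$ be an integer, let $d=N^2$, and let $b\in\ell_2^d$ be such that $G_d(b)$ is a basis in $\ell_2^d$ with Riesz basis bounds $A$ and $B$. Then, for all positive integers $Q,R$ with $1\le Q,R\le (N/16)\cdot\sqrt{A/B}$, $$\frac1N\sum_{j=NQ}^{d-1}|b(j)|^2+\frac1N\sum_{k=NR}^{d-1}|\mathcal{F}_d b(k)|^2\ge\frac{C}{QR}.$$
   Context: For $N\in\mathbb{N}$ put $d=N^2$ and $\mathbb{Z}_d=\mathbb{Z}/d\mathbb{Z}$. $\ell_2^d$ is the space of all functions $b:\mathbb{Z}_d\to\mathbb{C}$ with norm $\|b\|_d^2=\frac1N\sum_{j=0}^{d-1}|b(j)|^2$. The finite Fourier transform is $\mathcal{F}_d(b)(k)=\frac1N\sum_{j=0}^{d-1}b(j)e^{-2\pi i jk/d}$, which is unitary on $\ell_2^d$. Let $N\mathbb{Z}_d$ denote the set $\{Nk:k\in\mathbb{Z}\}$ modulo $d$. The Gabor system generated by $b\in\ell_2^d$ is $$G_d(b)=\{e^{2\pi i \ell j/d}\,b(j-k)\}_{(k,\ell)\in (N\mathbb{Z}_d)^2},$$ where each element is viewed as a function of $j\in\mathbb{Z}_d$. A system $\{f_n\}$ in a separable Hilbert space is a Riesz basis if it is complete and satisfies $A\sum|c_n|^2\le\|\sum c_nf_n\|^2\le B\sum|c_n|^2$ for all finite sequences of complex numbers $\{c_n\}$, with positive constants $A,B$; the largest such $A$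 and the smallest such $B$ are called the lower and upper Riesz basis bounds. Every basis of a finite dimensional space is a Riesz basis. *)

theory Defs
  imports "HOL-Analysis.Analysis" "HOL-Library.Function_Algebras"
begin

text \<open>
  Throughout \<open>d = N\<^sup>2\<close>. A function on \<open>\<int>/d\<int>\<close> is represented by a \<open>d\<close>-periodic function on
  \<^typ>\<open>int\<close>, so that translations \<open>b (j - k)\<close> and values at residue classes need no
  reduction modulo \<open>d\<close>.
\<close>

definition ell2 :: "nat \<Rightarrow> (int \<Rightarrow> complex) set" where
  "ell2 N = {b. \<forall>j. b (j + int (N\<^sup>2)) = b j}"

definition ell2_norm :: "nat \<Rightarrow> (int \<Rightarrow> complex) \<Rightarrow> real" where
  "ell2_norm N b = sqrt ((1 / real N) * (\<Sum>j = 0..<N\<^sup>2. (cmod (b (int j)))\<^sup>2))"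

definition finite_fourier :: "nat \<Rightarrow> (int \<Rightarrow> complex) \<Rightarrow> int \<Rightarrow> complex" where
  "finite_fourier N b k = (1 / of_nat N) *
     (\<Sum>j = 0..<N\<^sup>2. b (int j) * exp (- 2 * of_real pi * \<i> * of_int (int j * k) / of_nat (N\<^sup>2)))"

text \<open>The set \<open>N\<int>\<^sub>d\<close>, each residue class being given by its representative in \<open>{0..<d}\<close>.\<close>

definition multiples_mod :: "nat \<Rightarrow> int set" where
  "multiples_mod N = {(int N * k) mod int (N\<^sup>2) | k. True}"

definition gabor_index :: "nat \<Rightarrow> (int \<times> int) set" where
  "gabor_index N = multiples_mod N \<times> multiples_mod N"

definition gabor :: "nat \<Rightarrow> (int \<Rightarrow> complex) \<Rightarrow> int \<times> int \<Rightarrow> int \<Rightarrow> complex" where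
  "gabor N b = (\<lambda>(k, l) j. exp (2 * of_real pi * \<i> * of_int (l * j) / of_nat (N\<^sup>2)) * b (j - k))"

definition scale_fun :: "complex \<Rightarrow> (int \<Rightarrow> complex) \<Rightarrow> int \<Rightarrow> complex" where
  "scale_fun c f = (\<lambda>j. c * f j)"

interpretation cfun: vector_space scale_fun
  by unfold_locales (auto simp: scale_fun_def fun_eq_iff algebra_simps)

text \<open>
  A system is an indexed family, so a basis must not contain repetitions.
\<close>

definition is_basis :: "nat \<Rightarrow> 'i set \<Rightarrow> ('i \<Rightarrow> int \<Rightarrow> complex) \<Rightarrow> bool" where
  "is_basis N I f \<longleftrightarrow>
     inj_on f I \<and> cfun.independent (f ` I) \<and> cfun.span (f ` I) = ell2 N"

text \<open>
  The index sets are finite here, so finite coefficient sequences are just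
  arbitrary families of coefficients over the whole index set.
\<close>

definition lower_riesz_ineq :: "nat \<Rightarrow> 'i set \<Rightarrow> ('i \<Rightarrow> int \<Rightarrow> complex) \<Rightarrow> real \<Rightarrow> bool" where
  "lower_riesz_ineq N I f A \<longleftrightarrow>
     (\<forall>c. A * (\<Sum>n\<in>I. (cmod (c n))\<^sup>2) \<le> (ell2_norm N (\<Sum>n\<in>I. scale_fun (c n) (f n)))\<^sup>2)"

definition upper_riesz_ineq :: "nat \<Rightarrow> 'i set \<Rightarrow> ('i \<Rightarrow> int \<Rightarrow> complex) \<Rightarrow> real \<Rightarrow> bool" where
  "upper_riesz_ineq N I f B \<longleftrightarrow>
     (\<forall>c. (ell2_norm N (\<Sum>n\<in>I. scale_fun (c n) (f n)))\<^sup>2 \<le> B * (\<Sum>n\<in>I. (cmod (c n))\<^sup>2))"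

text \<open>The Riesz basis bounds are the optimal constants.\<close>

definition has_riesz_bounds :: "nat \<Rightarrow> 'i set \<Rightarrow> ('i \<Rightarrow> int \<Rightarrow> complex) \<Rightarrow> real \<Rightarrow> real \<Rightarrow> bool" where
  "has_riesz_bounds N I f A B \<longleftrightarrow>
     0 < A \<and> lower_riesz_ineq N I f A \<and> (\<forall>A'>0. lower_riesz_ineq N I f A' \<longrightarrow> A' \<le> A) \<and>
     0 < B \<and> upper_riesz_ineq N I f B \<and> (\<forall>B'>0. upper_riesz_ineq N I f B' \<longrightarrow> B \<le> B')"

end

theory Submission
  imports Defs
begin

text \<open>
  The Riesz bounds say that the finite Zak transform \<open>Z\<close> of \<open>b\<close> satisfies \<open>A \<le> |Z|\<^sup>2 \<le> B\<close>.
  Let \<open>w\<close> be a trapezoidal cutoff equal to \<open>1\<close> on \<open>{0..<N R}\<close>. If \<open>b\<close> has little Fourier mass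
  beyond \<open>N R\<close>, then \<open>Z\<close> is \<open>L\<^sup>2\<close>-close to the Zak transform of the function with Fourier
  transform \<open>w \<F>b\<close>, which varies slowly in the first variable because the kernel of \<open>w\<close> has
  small \<open>\<ell>\<^sup>1\<close> modulus of continuity. In the same way a cutoff of \<open>b\<close> itself at \<open>N Q\<close> gives
  slow variation in the second variable, up to a phase twist. On a grid with about \<open>R Q\<close> points (up to
  constants) a function as large as \<open>Z\<close> cannot have only small jumps: its arguments would add up
  to zero around each cell, after correction by the curvature of the twist, whereas
  quasi-periodicity forces the total curvature \<open>2 \<pi>\<close>. Hence every translate of the grid
  contains a point where one of the two approximations fails, and averaging over all
  translates bounds the approximation errors from below.
\<close>

section \<open>Additive characters modulo \<open>M\<close>, their orthogonality and Parseval's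
  identity\<close>

definition echar :: "nat \<Rightarrow> int \<Rightarrow> complex" where
  "echar M a = cis (2 * pi * of_int a / of_nat M)"

lemma echar_0 [simp]: "echar M 0 = 1"
  by (simp add: echar_def)

lemma norm_echar [simp]: "cmod (echar M a) = 1"
  by (simp add: echar_def)

lemma echar_nonzero [simp]: "echar M a \<noteq> 0"
  using norm_echar[of M a] by force

lemma echar_add: "echar M (a + b) = echar M a * echar M b"
  by (simp add: echar_def cis_mult ring_distribs add_divide_distrib)

lemma cnj_echar: "cnj (echar M a) = echar M (- a)"
  by (simp add: echar_def cis_cnj)

lemma echar_eq_1_iff:
  assumes "M > 0"
  shows "echar M a = 1 \<longleftrightarrow> int M dvd a"
proof
  assume "echar M a = 1"
  then have "exp (\<i> * of_real (2 * pi * of_int a / of_nat M)) = 1"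
    by (simp add: echar_def cis_conv_exp)
  then obtain n :: int where "2 * pi * of_int a / of_nat M = of_int (2 * n) * pi"
    by (auto simp: exp_eq_1)
  then have "2 * pi * of_int a = of_int (2 * n) * pi * of_nat M"
    using assms by (simp add: field_simps)
  then have "pi * (real_of_int a) = pi * (of_int (n * int M))"
    by (simp add: algebra_simps)
  then have "real_of_int a = of_int (n * int M)"
    using pi_neq_zero mult_cancel_left by blast
  then have "a = n * int M" by linarith
  then show "int M dvd a" by simp
next
  assume "int M dvd a"
  then obtain n where "a = int M * n" by auto
  then have "echar M a = cis ((2 * pi) * of_int n)"
    using assms by (simp add: echar_def mult.assoc)
  then show "echar M a = 1" by (simp only: cis_multiple_2pi Ints_of_int)
qed

lemma echar_period: "M > 0 \<Longrightarrow> int M dvd c \<Longrightarrow> echar M (a + c) = echar M a"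
  by (simp add: echar_add echar_eq_1_iff)

lemma echar_square: "N > 0 \<Longrightarrow> echar (N\<^sup>2) (int N * a) = echar N a"
  by (simp add: echar_def power2_eq_square mult.assoc)

lemma norm_echar_minus_1: "cmod (echar M a - 1) \<le> 2 * pi * \<bar>of_int a\<bar> / of_nat M"
proof -
  let ?x = "2 * pi * of_int a / of_nat M"
  have "cmod (echar M a - 1) = 2 * \<bar>sin (?x / 2)\<bar>"
    unfolding echar_def cis_conv_exp by (rule dist_exp_i_1)
  also have "\<dots> \<le> 2 * \<bar>?x / 2\<bar>"
    by (intro mult_left_mono abs_sin_x_le_abs_x) simp
  finally show ?thesis by (simp add: abs_mult)
qed

lemma periodic_shift:
  fixes f :: "int \<Rightarrow> 'a"
  assumes per: "\<And>k. f (k + p) = f k"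
  shows "f (k + p * q) = f k"
proof (induction q rule: int_induct[where k = 0])
  case (step1 i)
  then show ?case using per[of "k + p * i"] by (simp add: algebra_simps)
next
  case (step2 i)
  then show ?case using per[of "k + p * (i - 1)"] by (simp add: algebra_simps)
qed simp

lemma sum_periodic_shift:
  fixes f :: "int \<Rightarrow> 'a::comm_monoid_add"
  assumes per: "\<And>k. f (k + int M) = f k"
  shows "(\<Sum>k\<in>{0..<int M}. f (k + s)) = (\<Sum>k\<in>{0..<int M}. f k)"
proof -
  have md: "f (k mod int M) = f k" for k
    using periodic_shift[of f "int M" "k mod int M" "k div int M"] per
    by (simp add: mod_mult_div_eq)
  show ?thesis
    by (rule sum.reindex_bij_witness[where j = "\<lambda>k. (k + s) mod int M"
          and i = "\<lambda>k. (k - s) mod int M"]) (auto simp: mod_simps md)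
qed

text \<open>Advancing the summation index by one multiplies the sum by \<open>echar M a\<close>, so
  it vanishes unless that factor is 1.\<close>

lemma sum_echar:
  assumes "M > 0"
  shows "(\<Sum>k\<in>{0..<int M}. echar M (a * k)) = (if int M dvd a then of_nat M else 0)"
proof (cases "int M dvd a")
  case True
  then have "echar M (a * k) = 1" for k using assms by (simp add: echar_eq_1_iff)
  then show ?thesis using True by simp
next
  case False
  let ?S = "\<Sum>k\<in>{0..<int M}. echar M (a * k)"
  have "?S = (\<Sum>k\<in>{0..<int M}. echar M (a * (k + 1)))"
    by (rule sum_periodic_shift[symmetric]) (simp add: ring_distribs echar_period assms)
  also have "\<dots> = echar M a * ?S"
    by (simp add: ring_distribs echar_add sum_distrib_left mult.commute)
  finally have "?S * (echar M a - 1) = 0" by (simp add: algebra_simps)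
  then show ?thesis using False assms by (simp add: echar_eq_1_iff)
qed

text \<open>Expanding the squared modulus gives a sum over pairs of frequencies, and orthogonality
  leaves only the diagonal. The general form of \<open>I\<close> covers full periods as well as the
  short, partly negative intervals behind Dirichlet kernels.\<close>

lemma parseval_echar:
  fixes a :: "int \<Rightarrow> complex"
  assumes M: "M > 0" and "finite I"
    and incong: "\<And>f g. f \<in> I \<Longrightarrow> g \<in> I \<Longrightarrow> int M dvd f - g \<Longrightarrow> f = g"
  shows "(\<Sum>k\<in>{0..<int M}. (cmod (\<Sum>f\<in>I. a f * echar M (- (f * k))))\<^sup>2)
    = real M * (\<Sum>f\<in>I. (cmod (a f))\<^sup>2)"
proof -
  have "complex_of_real (\<Sum>k\<in>{0..<int M}. (cmod (\<Sum>f\<in>I. a f * echar M (- (f * k))))\<^sup>2)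
      = (\<Sum>k\<in>{0..<int M}. \<Sum>f\<in>I. \<Sum>g\<in>I. a f * cnj (a g) * echar M ((g - f) * k))"
    by (simp only: of_real_sum complex_norm_square cnj_sum sum_product)
      (simp add: cnj_echar echar_add algebra_simps diff_conv_add_uminus del: add_uminus_conv_diff)
  also have "\<dots> = (\<Sum>f\<in>I. \<Sum>g\<in>I. a f * cnj (a g) * (\<Sum>k\<in>{0..<int M}. echar M ((g - f) * k)))"
    by (subst sum.swap, rule sum.cong[OF refl], subst sum.swap) (simp add: sum_distrib_left)
  also have "\<dots> = (\<Sum>f\<in>I. \<Sum>g\<in>I. if g = f then of_nat M * (a f * cnj (a f)) else 0)"
    using incong by (intro sum.cong refl) (auto simp: sum_echar[OF M])
  also have "\<dots> = complex_of_real (real M * (\<Sum>f\<in>I. (cmod (a f))\<^sup>2))"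
    using \<open>finite I\<close>
    by (simp add: sum_distrib_left complex_norm_square del: of_real_power)
  finally show ?thesis using of_real_eq_iff by blast
qed

section \<open>The finite Zak transform\<close>

text \<open>A discrete Fourier transform of length \<open>N\<close> along each coset of the
  multiples of \<open>N\<close>. It is left unnormalised so that Riesz bounds become pointwise
  bounds on its squared modulus with the same constants.\<close>

definition zak :: "nat \<Rightarrow> (int \<Rightarrow> complex) \<Rightarrow> int \<Rightarrow> int \<Rightarrow> complex" where
  "zak N b m n = (\<Sum>j\<in>{0..<int N}. b (m + j * int N) * echar N (- (j * n)))"

lemma ell2_period: "b \<in> ell2 N \<Longrightarrow> b (j + int (N\<^sup>2)) = b j"
  by (simp add: ell2_def)

lemma zak_period_2: "N > 0 \<Longrightarrow> int N dvd c \<Longrightarrow> zak N b m (n + c) = zak N b m n"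
proof -
  assume N: "N > 0" and c: "int N dvd c"
  have "echar N (- (j * (n + c))) = echar N (- (j * n))" for j
    using echar_period[OF N, of "- (j * c)" "- (j * n)"] c by (simp add: algebra_simps)
  then show ?thesis by (simp only: zak_def)
qed

text \<open>The summand is \<open>N\<close>-periodic in \<open>j\<close>, so translating by
  \<open>N\<close> merely advances \<open>j\<close> by one and the character picks up a phase. This
  phase is the source of the total curvature \<open>2 * pi\<close>.\<close>

lemma zak_quasiperiod:
  assumes N: "N > 0" and b: "b \<in> ell2 N"
  shows "zak N b (m + int N) n = echar N n * zak N b m n"
proof -
  let ?f = "\<lambda>j. b (m + j * int N) * echar N (- (j * n))"
  have "?f (j + int N) = ?f j" for j
  proof -
    have "b (m + (j + int N) * int N) = b (m + j * int N)"
      using ell2_period[OF b, of "m + j * int N"] by (simp add: algebra_simps power2_eq_square)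
    moreover have "echar N (- ((j + int N) * n)) = echar N (- (j * n))"
      using echar_period[OF N, of "- (int N * n)" "- (j * n)"] by (simp add: algebra_simps)
    ultimately show ?thesis by simp
  qed
  then have "zak N b m n = (\<Sum>j\<in>{0..<int N}. ?f (j + 1))"
    unfolding zak_def by (rule sum_periodic_shift[symmetric])
  moreover have "echar N n * ?f (j + 1) = b (m + int N + j * int N) * echar N (- (j * n))" for j
  proof -
    have "echar N n * echar N (- ((j + 1) * n)) = echar N (- (j * n))"
      by (simp add: algebra_simps flip: echar_add)
    then show ?thesis by (simp add: algebra_simps)
  qed
  ultimately show ?thesis by (simp add: zak_def sum_distrib_left)
qed

lemma zak_period_1:
  assumes b: "b \<in> ell2 N"
  shows "zak N b (m + int (N\<^sup>2)) n = zak N b m n"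
proof -
  have "b (m + int (N\<^sup>2) + j * int N) = b (m + j * int N)" for j
    using ell2_period[OF b, of "m + j * int N"] by (simp only: add_ac)
  then show ?thesis by (simp only: zak_def)
qed

lemma norm_zak_period:
  assumes "N > 0" "b \<in> ell2 N"
  shows "cmod (zak N b (m + int N) n) = cmod (zak N b m n)"
    and "cmod (zak N b m (n + int N)) = cmod (zak N b m n)"
  using assms by (simp_all add: zak_quasiperiod zak_period_2 norm_mult)

lemma sum_residue_quotient:
  fixes f :: "int \<Rightarrow> 'a::comm_monoid_add"
  shows "(\<Sum>m\<in>{0..<int N}. \<Sum>j\<in>{0..<int N}. f (m + j * int N)) = (\<Sum>k\<in>{0..<int (N\<^sup>2)}. f k)"
proof -
  have lt: "m + j * int N < int N * int N" if "m < int N" "j < int N" for m j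
  proof -
    have "(j + 1) * int N \<le> int N * int N" using that by (intro mult_right_mono) auto
    then show ?thesis using that by (simp add: ring_distribs)
  qed
  show ?thesis
    unfolding sum.cartesian_product
  proof (rule sum.reindex_bij_witness[where j = "\<lambda>(m, j). m + j * int N"
          and i = "\<lambda>k. (k mod int N, k div int N)"])
    fix k assume "k \<in> {0..<int (N\<^sup>2)}"
    then have k: "0 \<le> k" "k < int N * int N" by (auto simp: power2_eq_square)
    then have N: "N > 0" by (cases N) auto
    have "k div int N < int N"
    proof (rule ccontr)
      assume "\<not> k div int N < int N"
      then have "int N * int N \<le> k div int N * int N" by (intro mult_right_mono) auto
      also have "\<dots> \<le> k" using N by (simp flip: minus_mod_eq_div_mult)
      finally show False using k by simp
    qed
    then show "(k mod int N, k div int N) \<in> {0..<int N} \<times> {0..<int N}"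
      using k N by (simp add: pos_imp_zdiv_nonneg_iff)
  qed (use lt in \<open>auto simp: power2_eq_square\<close>)
qed

text \<open>Parseval in \<open>n\<close> for each fixed \<open>m\<close>; the pairs
  \<open>(m, j)\<close> then run through all residues modulo \<open>N\<^sup>2\<close>.\<close>

lemma sum_norm_zak:
  assumes "N > 0"
  shows "(\<Sum>m\<in>{0..<int N}. \<Sum>n\<in>{0..<int N}. (cmod (zak N b m n))\<^sup>2)
    = real N * (\<Sum>j\<in>{0..<int (N\<^sup>2)}. (cmod (b j))\<^sup>2)"
proof -
  have inc: "f = g" if "f \<in> {0..<int N}" "g \<in> {0..<int N}" "int N dvd f - g" for f g
    using that by (auto simp: mod_eq_dvd_iff[symmetric])
  have "(\<Sum>n\<in>{0..<int N}. (cmod (zak N b m n))\<^sup>2)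
      = real N * (\<Sum>j\<in>{0..<int N}. (cmod (b (m + j * int N)))\<^sup>2)" for m
    unfolding zak_def
    by (rule parseval_echar[where a = "\<lambda>j. b (m + j * int N)"]) (use assms inc in auto)
  then show ?thesis
    by (simp add: sum_residue_quotient[of "\<lambda>k. (cmod (b k))\<^sup>2"] flip: sum_distrib_left)
qed

section \<open>Plancherel's identity and the smoothing kernel\<close>

lemma sum_nat_int: "(\<Sum>j = a..<b. f (int j)) = (\<Sum>j\<in>{int a..<int b}. f j)"
  using sum.reindex[of int "{a..<b}" f] by (simp add: image_int_atLeastLessThan)

lemma finite_fourier_echar:
  "finite_fourier N b k = (1 / of_nat N) * (\<Sum>j\<in>{0..<int (N\<^sup>2)}. b j * echar (N\<^sup>2) (- (j * k)))"
  unfolding finite_fourier_def echar_def cis_conv_exp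
  using sum_nat_int[of "\<lambda>j. b j * exp (\<i> * complex_of_real (2 * pi * real_of_int (- (j * k)) / real (N\<^sup>2)))" 0 "N\<^sup>2"]
  by (simp add: mult_ac)

lemma plancherel_finite_fourier:
  assumes "N > 0"
  shows "(\<Sum>k\<in>{0..<int (N\<^sup>2)}. (cmod (finite_fourier N b k))\<^sup>2) = (\<Sum>j\<in>{0..<int (N\<^sup>2)}. (cmod (b j))\<^sup>2)"
proof -
  have inc: "f = g" if "f \<in> {0..<int (N\<^sup>2)}" "g \<in> {0..<int (N\<^sup>2)}" "int (N\<^sup>2) dvd f - g" for f g
    using that unfolding mod_eq_dvd_iff[symmetric] by auto
  have "(\<Sum>k\<in>{0..<int (N\<^sup>2)}. (cmod (finite_fourier N b k))\<^sup>2)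
      = (1 / real N)\<^sup>2 * (\<Sum>k\<in>{0..<int (N\<^sup>2)}. (cmod (\<Sum>j\<in>{0..<int (N\<^sup>2)}. b j * echar (N\<^sup>2) (- (j * k))))\<^sup>2)"
    unfolding finite_fourier_echar norm_mult power_mult_distrib sum_distrib_left[symmetric]
    by (simp add: norm_divide)
  also have "\<dots> = (1 / real N)\<^sup>2 * (real (N\<^sup>2) * (\<Sum>j\<in>{0..<int (N\<^sup>2)}. (cmod (b j))\<^sup>2))"
    by (subst parseval_echar) (use assms inc in auto)
  finally show ?thesis using assms by (simp add: power_divide)
qed

text \<open>The cutoff \<open>w\<close> is the convolution of the indicators of \<open>{-P<..<P}\<close> and \<open>{0..<P}\<close>, divided
  by \<open>P\<close>; its kernel \<open>\<psi>\<close> is then a product of two Dirichlet kernels, so that Cauchy-Schwarz and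
  Parseval control the \<open>\<ell>\<^sup>1\<close> norms.\<close>

lemma smoothing_kernel:
  assumes P: "0 < P" and Pd: "2 * P \<le> d"
  obtains \<psi> :: "int \<Rightarrow> complex" and w :: "int \<Rightarrow> complex"
  where "\<And>k. \<psi> (k + int d) = \<psi> k"
    and "\<And>j. w j = (\<Sum>k\<in>{0..<int d}. \<psi> k * echar d (j * k))"
    and "\<And>j. cmod (1 - w j) \<le> 1"
    and "\<And>j. 0 \<le> j \<Longrightarrow> j < int P \<Longrightarrow> w j = 1"
    and "\<And>t. (\<Sum>k\<in>{0..<int d}. cmod (\<psi> (k + t) - \<psi> k)) \<le> 4 * sqrt 2 * pi * P * \<bar>of_int t\<bar> / d"
proof
  have d: "d > 0" using assms by simp
  define I where "I = {- int P<..<int P}"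
  define J where "J = {0..<int P}"
  define D where "D = (\<lambda>S k. \<Sum>f\<in>S. echar d (- (f * k)))"
  define \<psi> where "\<psi> = (\<lambda>k. D I k * D J k / (of_nat d * of_nat P))"
  define w where "w = (\<lambda>j. \<Sum>k\<in>{0..<int d}. \<psi> k * echar d (j * k))"
  have fin: "finite I" "finite J" by (auto simp: I_def J_def)
  have cardI: "real (card I) \<le> 2 * real P" using P by (auto simp: I_def)
  have cardJ: "card J = P" by (simp add: J_def)
  \<comment> \<open>Two elements of \<open>I\<close> differ by less than \<open>2 * P\<close>, which
    \<open>Pd\<close> bounds by the period.\<close>
  have incI: "f = g" if "f \<in> I" "g \<in> I" "int d dvd f - g" for f g
  proof (rule ccontr)
    assume "f \<noteq> g"
    then have "int d \<le> \<bar>f - g\<bar>" using that(3) by (intro zdvd_imp_le) auto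
    moreover have "\<bar>f - g\<bar> < 2 * int P" using that(1,2) by (auto simp: I_def)
    ultimately show False using Pd by linarith
  qed
  have incJ: "f = g" if "f \<in> J" "g \<in> J" "int d dvd f - g" for f g
  proof (rule ccontr)
    assume "f \<noteq> g"
    then have "int d \<le> \<bar>f - g\<bar>" using that(3) by (intro zdvd_imp_le) auto
    moreover have "\<bar>f - g\<bar> < 2 * int P" using that(1,2) by (auto simp: J_def)
    ultimately show False using Pd by linarith
  qed
  have Dper: "D S (k + int d) = D S k" for S k
    unfolding D_def
  proof (intro sum.cong refl)
    fix f show "echar d (- (f * (k + int d))) = echar d (- (f * k))"
      using echar_period[OF d, of "- (f * int d)" "- (f * k)"] by (simp add: algebra_simps)
  qed
  show "\<psi> (k + int d) = \<psi> k" for k by (simp add: \<psi>_def Dper)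
  show "w j = (\<Sum>k\<in>{0..<int d}. \<psi> k * echar d (j * k))" for j by (simp add: w_def)

  \<comment> \<open>The convolution of the two indicators modulo \<open>d\<close>:
    \<open>w j\<close> will turn out to be \<open>c j / P\<close>.\<close>
  define c where "c = (\<lambda>j. card {g \<in> J. \<exists>f\<in>I. int d dvd j - f - g})"
  \<comment> \<open>By \<open>incI\<close> at most one \<open>f\<close> is congruent to
    \<open>j - g\<close>, so the sum over \<open>I\<close> collapses to an indicator.\<close>
  have one: "(\<Sum>f\<in>I. if int d dvd j - f - g then of_nat d else 0)
      = (if \<exists>f\<in>I. int d dvd j - f - g then of_nat d else (0::complex))" for j g
  proof (cases "\<exists>f\<in>I. int d dvd j - f - g")
    case True
    then obtain f0 where f0: "f0 \<in> I" "int d dvd j - f0 - g" by blast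
    have "int d dvd j - f - g \<longleftrightarrow> f = f0" if "f \<in> I" for f
      using incI[OF f0(1) that] dvd_diff[of "int d" "j - f - g" "j - f0 - g"] f0(2) by auto
    then have "(\<Sum>f\<in>I. if int d dvd j - f - g then of_nat d else 0)
        = (\<Sum>f\<in>I. if f = f0 then of_nat d else (0::complex))"
      by (intro sum.cong refl) auto
    then show ?thesis using True f0 fin by simp
  qed auto
  have w_c: "w j = of_real (c j / P)" for j
  proof -
    have "w j = (\<Sum>k\<in>{0..<int d}. \<Sum>g\<in>J. \<Sum>f\<in>I. echar d ((j - f - g) * k)) / (of_nat d * of_nat P)"
      unfolding w_def sum_divide_distrib[of _ "{0..<int d}"]
    proof (intro sum.cong refl)
      fix k
      have "D I k * D J k * echar d (j * k)
          = (\<Sum>f\<in>I. \<Sum>g\<in>J. echar d (- (f * k)) * echar d (- (g * k)) * echar d (j * k))"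
        by (simp only: D_def sum_product) (simp only: sum_distrib_right)
      also have "\<dots> = (\<Sum>f\<in>I. \<Sum>g\<in>J. echar d ((j - f - g) * k))"
        by (simp add: algebra_simps flip: echar_add)
      also have "\<dots> = (\<Sum>g\<in>J. \<Sum>f\<in>I. echar d ((j - f - g) * k))"
        by (rule sum.swap)
      finally show "\<psi> k * echar d (j * k)
          = (\<Sum>g\<in>J. \<Sum>f\<in>I. echar d ((j - f - g) * k)) / (of_nat d * of_nat P)"
        by (simp add: \<psi>_def)
    qed
    also have "(\<Sum>k\<in>{0..<int d}. \<Sum>g\<in>J. \<Sum>f\<in>I. echar d ((j - f - g) * k))
        = (\<Sum>g\<in>J. \<Sum>f\<in>I. \<Sum>k\<in>{0..<int d}. echar d ((j - f - g) * k))"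
      by (subst sum.swap, rule sum.cong[OF refl], subst sum.swap) (rule refl)
    also have "\<dots> = (\<Sum>g\<in>J. if \<exists>f\<in>I. int d dvd j - f - g then of_nat d else 0)"
      by (simp add: sum_echar[OF d] one)
    also have "\<dots> = of_nat d * of_nat (c j)"
      using fin by (simp add: c_def sum.If_cases Int_def conj_commute)
    finally show ?thesis using d by simp
  qed
  have c_le: "c j \<le> P" for j
    unfolding c_def using card_mono[OF fin(2), of "{g \<in> J. \<exists>f\<in>I. int d dvd j - f - g}"]
    by (simp add: cardJ)
  show "cmod (1 - w j) \<le> 1" for j
  proof -
    have "cmod (1 - w j) = \<bar>1 - c j / P\<bar>"
      unfolding w_c by (metis norm_of_real of_real_1 of_real_diff)
    also have "\<dots> \<le> 1" using c_le[of j] P by (simp add: field_simps abs_le_iff)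
    finally show ?thesis .
  qed
  show "w j = 1" if j: "0 \<le> j" "j < int P" for j
  proof -
    \<comment> \<open>The plateau of the trapezoid: differences of elements of
      \<open>{0..<P}\<close> lie in \<open>I\<close>, so every \<open>g\<close> is counted.\<close>
    have "\<exists>f\<in>I. int d dvd j - f - g" if "g \<in> J" for g
      using j that by (intro bexI[of _ "j - g"]) (auto simp: I_def J_def)
    then have "{g \<in> J. \<exists>f\<in>I. int d dvd j - f - g} = J" by blast
    then show ?thesis using P by (simp add: w_c c_def cardJ)
  qed

  show "(\<Sum>k\<in>{0..<int d}. cmod (\<psi> (k + t) - \<psi> k)) \<le> 4 * sqrt 2 * pi * P * \<bar>of_int t\<bar> / d" for t
  proof -
    \<comment> \<open>Differencing a Dirichlet kernel with step \<open>t\<close> multiplies its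
      coefficient at \<open>f\<close> by \<open>echar d (- (f * t)) - 1\<close>, which has modulus
      at most \<open>h\<close> when \<open>f\<close> lies in \<open>I\<close>.\<close>
    define h where "h = 2 * pi * P * \<bar>of_int t\<bar> / d"
    have h0: "h \<ge> 0" by (simp add: h_def)
    define nrm where "nrm = (\<lambda>F::int \<Rightarrow> complex. L2_set (\<lambda>k. cmod (F k)) {0..<int d})"
    have nD: "nrm (D S) = sqrt (d * card S)" if "finite S" 
      "\<And>f g. f \<in> S \<Longrightarrow> g \<in> S \<Longrightarrow> int d dvd f - g \<Longrightarrow> f = g" for S
      using parseval_echar[OF d that, of "\<lambda>_. 1"] by (simp add: nrm_def L2_set_def D_def)
    have ndD: "nrm (\<lambda>k. D S (k + t) - D S k) \<le> h * sqrt (d * card S)" if "finite S" "S \<subseteq> I"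
      "\<And>f g. f \<in> S \<Longrightarrow> g \<in> S \<Longrightarrow> int d dvd f - g \<Longrightarrow> f = g" for S
    proof -
      have eq: "D S (k + t) - D S k = (\<Sum>f\<in>S. (echar d (- (f * t)) - 1) * echar d (- (f * k)))" for k
        by (simp add: D_def algebra_simps sum_subtractf flip: echar_add)
      have le: "cmod (echar d (- (f * t)) - 1) \<le> h" if "f \<in> S" for f
      proof -
        have "f \<in> I" using that \<open>S \<subseteq> I\<close> by blast
        then have "\<bar>f\<bar> \<le> int P" unfolding I_def greaterThanLessThan_iff by linarith
        then have "\<bar>real_of_int f\<bar> \<le> P" by linarith
        then have "\<bar>real_of_int f\<bar> * \<bar>of_int t\<bar> \<le> P * \<bar>real_of_int t\<bar>"
          by (rule mult_right_mono) simp
        then have "2 * pi * (\<bar>real_of_int f\<bar> * \<bar>of_int t\<bar>) / d \<le> 2 * pi * (P * \<bar>of_int t\<bar>) / d"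
          by (intro divide_right_mono mult_left_mono) auto
        then show ?thesis
          using norm_echar_minus_1[of d "- (f * t)"] by (simp add: h_def abs_mult mult.assoc)
      qed
      have "(\<Sum>k\<in>{0..<int d}. (cmod (D S (k + t) - D S k))\<^sup>2)
          = d * (\<Sum>f\<in>S. (cmod (echar d (- (f * t)) - 1))\<^sup>2)"
        unfolding eq by (rule parseval_echar[OF d that(1,3)])
      also have "\<dots> \<le> d * (\<Sum>f\<in>S. h\<^sup>2)"
        by (intro mult_left_mono sum_mono power_mono le) auto
      also have "\<dots> = h\<^sup>2 * (d * card S)" by simp
      finally have "nrm (\<lambda>k. D S (k + t) - D S k) \<le> sqrt (h\<^sup>2 * (d * card S))"
        unfolding nrm_def L2_set_def by (rule real_sqrt_le_mono)
      then show ?thesis using h0 by (simp add: real_sqrt_mult)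
    qed
    have nshift: "nrm (\<lambda>k. D S (k + t)) = nrm (D S)" for S
      unfolding nrm_def L2_set_def
      using sum_periodic_shift[of "\<lambda>k. (cmod (D S k))\<^sup>2" d t] by (simp add: Dper)
    have CS: "(\<Sum>k\<in>{0..<int d}. cmod (F k) * cmod (G k)) \<le> nrm F * nrm G" for F G
      using L2_set_mult_ineq[of "\<lambda>k. cmod (F k)" "\<lambda>k. cmod (G k)"] by (simp add: nrm_def)
    have JI: "J \<subseteq> I" by (auto simp: I_def J_def)
    \<comment> \<open>A discrete product rule: each term pairs one differenced kernel with one plain
      kernel, ready for Cauchy-Schwarz.\<close>
    have split: "\<psi> (k + t) - \<psi> k = ((D I (k + t) - D I k) * D J (k + t) + D I k * (D J (k + t) - D J k)) / (of_nat d * of_nat P)" for k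
      by (simp add: \<psi>_def algebra_simps diff_divide_distrib)
    have "(\<Sum>k\<in>{0..<int d}. cmod (\<psi> (k + t) - \<psi> k))
        \<le> (\<Sum>k\<in>{0..<int d}. (cmod (D I (k + t) - D I k) * cmod (D J (k + t)) + cmod (D I k) * cmod (D J (k + t) - D J k)) / (d * P))"
    proof (rule sum_mono)
      fix k
      have "cmod ((D I (k + t) - D I k) * D J (k + t) + D I k * (D J (k + t) - D J k))
          \<le> cmod (D I (k + t) - D I k) * cmod (D J (k + t)) + cmod (D I k) * cmod (D J (k + t) - D J k)"
        unfolding norm_mult[symmetric] by (rule norm_triangle_ineq)
      from divide_right_mono[OF this, of "real d * real P"]
      show "cmod (\<psi> (k + t) - \<psi> k)
          \<le> (cmod (D I (k + t) - D I k) * cmod (D J (k + t)) + cmod (D I k) * cmod (D J (k + t) - D J k)) / (d * P)"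
        by (simp only: split norm_divide norm_mult norm_of_nat) simp
    qed
    also have "\<dots> = ((\<Sum>k\<in>{0..<int d}. cmod (D I (k + t) - D I k) * cmod (D J (k + t)))
         + (\<Sum>k\<in>{0..<int d}. cmod (D I k) * cmod (D J (k + t) - D J k))) / (d * P)"
      by (simp add: sum.distrib flip: sum_divide_distrib)
    also have "\<dots> \<le> (h * sqrt (d * card I) * sqrt (d * P) + sqrt (d * card I) * (h * sqrt (d * P))) / (d * P)"
    proof (intro divide_right_mono add_mono)
      show "(\<Sum>k\<in>{0..<int d}. cmod (D I (k + t) - D I k) * cmod (D J (k + t)))
          \<le> h * sqrt (d * card I) * sqrt (d * P)"
        using CS[of "\<lambda>k. D I (k + t) - D I k" "\<lambda>k. D J (k + t)"]
          mult_right_mono[OF ndD[OF fin(1) order.refl incI], of "nrm (D J)"]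
        by (simp add: nshift nD[OF fin(2) incJ] cardJ)
      show "(\<Sum>k\<in>{0..<int d}. cmod (D I k) * cmod (D J (k + t) - D J k))
          \<le> sqrt (d * card I) * (h * sqrt (d * P))"
        using CS[of "D I" "\<lambda>k. D J (k + t) - D J k"]
          mult_left_mono[OF ndD[OF fin(2) JI incJ], of "nrm (D I)"]
        by (simp add: nD[OF fin(1) incI] cardJ)
    qed auto
    also have "\<dots> = 2 * h * sqrt (card I) * (sqrt d * sqrt d) * sqrt P / (d * P)"
    proof -
      have "h * (x * y) * (x * z) + (x * y) * (h * (x * z)) = 2 * h * y * (x * x) * z" for x y z :: real
        by algebra
      then show ?thesis by (simp only: of_nat_mult real_sqrt_mult)
    qed
    also have "sqrt d * sqrt d = real d" by simp
    also have "2 * h * sqrt (card I) * real d * sqrt P / (d * P) = 2 * h * sqrt (card I) * (sqrt P / P)"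
      using d by simp
    also have "\<dots> = 2 * h * sqrt (card I) / sqrt P"
      unfolding sqrt_divide_self_eq[OF of_nat_0_le_iff] by (simp add: divide_inverse)
    \<comment> \<open>The factor \<open>sqrt 2\<close> of the final bound comes from
      \<open>I\<close> being about twice as long as \<open>J\<close>.\<close>
    also have "\<dots> \<le> 2 * h * sqrt (2 * P) / sqrt P"
      using cardI h0 by (intro divide_right_mono mult_left_mono real_sqrt_le_mono) auto
    also have "\<dots> = 2 * h * sqrt 2" using P by (simp add: real_sqrt_mult)
    also have "\<dots> = 4 * sqrt 2 * pi * P * \<bar>of_int t\<bar> / d" by (simp add: h_def)
    finally show ?thesis .
  qed
qed

section \<open>Phase increments and the winding argument\<close>

text \<open>By the law of cosines the angle has cosine at least \<open>1 / 4\<close>, which keeps it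
  \<open>1 / 4\<close> away from a right angle. Four such angles add up to at most
  \<open>2 * pi - 1\<close>, leaving room for the curvature of one cell.\<close>

lemma abs_Arg_le:
  assumes "A > 0" and z: "A \<le> (cmod z)\<^sup>2" and w: "A \<le> (cmod w)\<^sup>2"
    and zw: "(cmod (z - w))\<^sup>2 \<le> 3 / 2 * A"
  shows "\<bar>Arg (z * cnj w)\<bar> \<le> pi / 2 - 1 / 4"
proof (rule ccontr)
  let ?p = "cmod z * cmod w" and ?t = "\<bar>Arg (z * cnj w)\<bar>"
  assume "\<not> ?t \<le> pi / 2 - 1 / 4"
  then have t: "pi / 2 - 1 / 4 < ?t" by simp
  have "A\<^sup>2 \<le> (cmod z)\<^sup>2 * (cmod w)\<^sup>2"
    unfolding power2_eq_square[of A] using \<open>A > 0\<close> z w by (intro mult_mono) auto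
  then have Ap: "A \<le> ?p"
    unfolding power_mult_distrib[symmetric] by (rule power2_le_imp_le) simp
  then have nz: "z * cnj w \<noteq> 0" using \<open>A > 0\<close> by auto
  have "(cmod (z - w))\<^sup>2 = (cmod z)\<^sup>2 + (cmod w)\<^sup>2 - 2 * Re (z * cnj w)"
    unfolding cmod_power2 by (simp add: power2_eq_square algebra_simps)
  moreover have "2 * ?p \<le> (cmod z)\<^sup>2 + (cmod w)\<^sup>2"
    using sum_squares_bound[of "cmod z" "cmod w"] by simp
  ultimately have "?p / 4 \<le> Re (z * cnj w)" using zw Ap by linarith
  moreover have "cos ?t = Re (z * cnj w) / ?p"
    using arg_cong[OF cis_Arg[OF nz], of Re] by (simp add: sgn_eq norm_mult)
  ultimately have "1 / 4 \<le> cos ?t" using Ap \<open>A > 0\<close> by (simp add: field_simps)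
  moreover have "cos ?t = sin (pi / 2 - ?t)" by (simp add: sin_diff)
  moreover have "sin (pi / 2 - ?t) < 1 / 4"
  proof (cases "?t \<le> pi / 2")
    case True
    then have "sin (pi / 2 - ?t) \<le> pi / 2 - ?t" by (intro sin_x_le_x) auto
    then show ?thesis using t by linarith
  next
    case False
    then have "0 \<le> sin (?t - pi / 2)"
      using Arg_bounded[of "z * cnj w"] pi_gt_zero by (intro sin_ge_zero) (auto simp: abs_le_iff)
    then show ?thesis by (simp add: sin_diff)
  qed
  ultimately show False by linarith
qed

lemma cis_Arg_mult_cnj:
  assumes "z \<noteq> 0" "w \<noteq> 0"
  shows "cis (Arg (z * cnj w)) = sgn z * cnj (sgn w)"
proof -
  have "cis (Arg (z * cnj w)) = sgn (z * cnj w)"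
    using assms by (intro cis_Arg) simp
  then show ?thesis by (simp add: sgn_eq norm_mult)
qed

text \<open>A discrete winding argument. \<open>h\<close> and \<open>v\<close> are phase increments
  along the edges of the grid, with \<open>v\<close> measured relative to the twist. Summed over all
  cells they telescope away by periodicity, whereas the curvatures add up to
  \<open>2 * pi\<close>.\<close>

lemma quasiperiodic_large_jump:
  fixes Z :: "int \<Rightarrow> int \<Rightarrow> complex" and X Y :: "nat \<Rightarrow> int"
  assumes N: "N > 0" and A: "A > 0"
    and Z: "\<And>m n. A \<le> (cmod (Z m n))\<^sup>2"
    and qp1: "\<And>m n. Z (m + int N) n = echar N n * Z m n"
    and qp2: "\<And>m n. Z m (n + int N) = Z m n"
    and XK: "X K = X 0 + int N" and YL: "Y L = Y 0 + int N"
    and X: "\<And>i. i < K \<Longrightarrow> 0 \<le> X (Suc i) - X i \<and> 16 * (X (Suc i) - X i) \<le> int N"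
    and Y: "\<And>j. j < L \<Longrightarrow> 0 \<le> Y (Suc j) - Y j \<and> 16 * (Y (Suc j) - Y j) \<le> int N"
    and jump1: "\<And>i j. i < K \<Longrightarrow> j \<le> L \<Longrightarrow>
      (cmod (Z (X (Suc i)) (Y j) - Z (X i) (Y j)))\<^sup>2 \<le> 3 / 2 * A"
    and jump2: "\<And>i j. i \<le> K \<Longrightarrow> j < L \<Longrightarrow>
      (cmod (Z (X i) (Y (Suc j)) - echar (N\<^sup>2) (X i * (Y (Suc j) - Y j)) * Z (X i) (Y j)))\<^sup>2 \<le> 3 / 2 * A"
  shows False
proof -
  define E where "E = (\<lambda>i j. echar (N\<^sup>2) (X i * (Y (Suc j) - Y j)))"
  define u where "u = (\<lambda>i j. sgn (Z (X i) (Y j)))"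
  define h where "h = (\<lambda>i j. Arg (Z (X (Suc i)) (Y j) * cnj (Z (X i) (Y j))))"
  define v where "v = (\<lambda>i j. Arg (Z (X i) (Y (Suc j)) * cnj (E i j * Z (X i) (Y j))))"
  \<comment> \<open>the curvature of the phase twist \<open>E\<close> over a cell\<close>
  define \<kappa> where "\<kappa> = (\<lambda>i j. 2 * pi * of_int ((X (Suc i) - X i) * (Y (Suc j) - Y j)) / of_nat (N\<^sup>2))"
  have nz: "Z m n \<noteq> 0" for m n using Z[of m n] A by auto
  have E1: "cmod (E i j) = 1" for i j by (simp add: E_def)
  have unit: "z * cnj z = 1" if "cmod z = 1" for z
    using complex_norm_square[of z] that by simp
  have u1: "u i j * cnj (u i j) = 1" for i j
    using nz by (intro unit) (simp add: u_def norm_sgn)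
  have E_nz: "E i j \<noteq> 0" for i j by (simp add: E_def)
  have cis_h: "cis (h i j) = u (Suc i) j * cnj (u i j)" for i j
    using nz by (simp add: h_def u_def cis_Arg_mult_cnj)
  have cis_v: "cis (v i j) = u i (Suc j) * cnj (E i j) * cnj (u i j)" for i j
  proof -
    have "cis (v i j) = sgn (Z (X i) (Y (Suc j))) * cnj (sgn (E i j * Z (X i) (Y j)))"
      unfolding v_def by (rule cis_Arg_mult_cnj) (use nz E_nz in auto)
    then show ?thesis by (simp add: u_def sgn_mult sgn_eq[of "E i j"] E1)
  qed
  have h_le: "\<bar>h i j\<bar> \<le> pi / 2 - 1 / 4" if "i < K" "j \<le> L" for i j
    unfolding h_def using A Z Z jump1[OF that] by (rule abs_Arg_le)
  have v_le: "\<bar>v i j\<bar> \<le> pi / 2 - 1 / 4" if "i \<le> K" "j < L" for i j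
    unfolding v_def by (rule abs_Arg_le[OF A Z])
      (use Z jump2[OF that] E1 in \<open>auto simp: norm_mult E_def\<close>)
  \<comment> \<open>All unit phases cancel around a cell, so the sum is a multiple of
    \<open>2 * pi\<close>; its size then forces it to be zero.\<close>
  have plaquette: "h i j - h i (Suc j) + (v (Suc i) j - v i j) + \<kappa> i j = 0" (is "?S = 0")
    if ij: "i < K" "j < L" for i j
  proof -
    have \<kappa>: "0 \<le> \<kappa> i j" "\<kappa> i j < 1"
    proof -
      let ?a = "X (Suc i) - X i" and ?b = "Y (Suc j) - Y j"
      show "0 \<le> \<kappa> i j" using X[OF ij(1)] Y[OF ij(2)] by (simp add: \<kappa>_def)
      \<comment> \<open>Both sides of the cell are at most \<open>N / 16\<close>, so its curvature
        is at most \<open>2 * pi / 256\<close>.\<close>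
      have "(16 * ?a) * (16 * ?b) \<le> int N * int N"
        using X[OF ij(1)] Y[OF ij(2)] by (intro mult_mono) auto
      then have "256 * (?a * ?b) \<le> int (N\<^sup>2)" by (simp add: power2_eq_square algebra_simps)
      then have "256 * real_of_int (?a * ?b) \<le> N\<^sup>2" by linarith
      then have "real_of_int (?a * ?b) / N\<^sup>2 \<le> 1 / 256" using N by (simp add: field_simps)
      then have "2 * pi * (real_of_int (?a * ?b) / N\<^sup>2) \<le> 2 * pi * (1 / 256)"
        by (intro mult_left_mono) auto
      also have "\<dots> < 1" using pi_less_4 by simp
      finally show "\<kappa> i j < 1" by (simp add: \<kappa>_def)
    qed
    have "cis (\<kappa> i j) = echar (N\<^sup>2) ((X (Suc i) - X i) * (Y (Suc j) - Y j))"
      by (simp add: \<kappa>_def echar_def)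
    also have "\<dots> = E (Suc i) j * cnj (E i j)"
      by (simp add: E_def cnj_echar left_diff_distrib flip: echar_add)
    finally have cis_\<kappa>: "cis (\<kappa> i j) = E (Suc i) j * cnj (E i j)" .
    have EE: "E i j * cnj (E i j) = 1" for i j
      using E1 by (rule unit)
    have "cis ?S = cis (h i j) * cnj (cis (h i (Suc j))) * cis (v (Suc i) j) * cnj (cis (v i j)) * cis (\<kappa> i j)"
      by (simp add: cis_mult cis_cnj algebra_simps)
    also have "\<dots> = (u (Suc i) j * cnj (u (Suc i) j)) * (u i j * cnj (u i j)) 
        * (u i (Suc j) * cnj (u i (Suc j))) * (u (Suc i) (Suc j) * cnj (u (Suc i) (Suc j)))
        * (E (Suc i) j * cnj (E (Suc i) j)) * (E i j * cnj (E i j))"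
      unfolding cis_h cis_v cis_\<kappa> complex_cnj_mult complex_cnj_cnj by (simp only: mult_ac)
    also have "\<dots> = 1" unfolding u1 EE by simp
    finally have "cos ?S = 1" by (metis cis.sel(1) one_complex.sel(1))
    then obtain n :: int where n: "?S = of_int n * 2 * pi" by (auto simp: cos_one_2pi_int)
    \<comment> \<open>The four edges contribute at most \<open>2 * pi - 1\<close>, and the curvature
      is strictly below 1.\<close>
    have "\<bar>?S\<bar> < 2 * pi"
      using h_le[of i j] h_le[of i "Suc j"] v_le[of i j] v_le[of "Suc i" j] ij \<kappa> by (simp add: abs_le_iff abs_less_iff)
    then have "\<bar>real_of_int n\<bar> * (2 * pi) < 1 * (2 * pi)" unfolding n by (simp add: abs_mult)
    then have "\<bar>real_of_int n\<bar> < 1" by (simp only: mult_less_cancel_right) auto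
    then show ?thesis using n by simp
  qed
  have hL: "h i L = h i 0" for i by (simp add: h_def YL qp2)
  \<comment> \<open>Across one period the phases gained by \<open>Z\<close> at both ends of the edge
    and by the twist \<open>E\<close> cancel, so \<open>v\<close> is periodic although
    \<open>Z\<close> is not.\<close>
  have vK: "v K j = v 0 j" for j
  proof -
    let ?Z1 = "Z (X 0) (Y (Suc j))" and ?Z0 = "Z (X 0) (Y j)"
    have "E K j = E 0 j * echar N (Y (Suc j) - Y j)"
      unfolding E_def XK echar_square[OF N, symmetric] distrib_right echar_add ..
    moreover have "echar N (Y (Suc j)) = echar N (Y (Suc j) - Y j) * echar N (Y j)"
      by (simp flip: echar_add)
    ultimately have "E K j * Z (X K) (Y j) = echar N (Y (Suc j)) * (E 0 j * ?Z0)"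
      by (simp only: XK qp1 mult_ac)
    then have "Z (X K) (Y (Suc j)) * cnj (E K j * Z (X K) (Y j))
        = (echar N (Y (Suc j)) * cnj (echar N (Y (Suc j)))) * (?Z1 * cnj (E 0 j * ?Z0))"
      by (simp only: XK qp1 complex_cnj_mult mult_ac)
    also have "echar N (Y (Suc j)) * cnj (echar N (Y (Suc j))) = 1"
      by (rule unit) simp
    finally show ?thesis by (simp add: v_def)
  qed
  have "0 = (\<Sum>i<K. \<Sum>j<L. h i j - h i (Suc j) + (v (Suc i) j - v i j) + \<kappa> i j)"
    using plaquette by simp
  also have "\<dots> = (\<Sum>i<K. \<Sum>j<L. h i j - h i (Suc j)) + (\<Sum>j<L. \<Sum>i<K. v (Suc i) j - v i j)
      + (\<Sum>i<K. \<Sum>j<L. \<kappa> i j)"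
    by (simp only: sum.distrib sum.swap[of "\<lambda>i j. v (Suc i) j - v i j"])
  also have "\<dots> = (\<Sum>i<K. \<Sum>j<L. \<kappa> i j)"
    by (simp add: sum_lessThan_telescope' hL vK sum_lessThan_telescope[of "\<lambda>i. v i j" for j])
  also have "\<dots> = 2 * pi * (of_int (\<Sum>i<K. X (Suc i) - X i) * of_int (\<Sum>j<L. Y (Suc j) - Y j)) / of_nat (N\<^sup>2)"
    unfolding of_int_sum sum_product
    by (simp add: \<kappa>_def sum_distrib_left sum_divide_distrib)
  also have "\<dots> = 2 * pi"
    unfolding sum_lessThan_telescope using N by (simp add: XK YL power2_eq_square)
  finally show False by simp
qed

section \<open>Smoothing and cutoffs on the Zak side\<close>

text \<open>A correlation rather than a convolution: with the sign in \<open>j + k\<close>, the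
  Fourier multiplier is the sum that defines the cutoff \<open>w\<close>.\<close>

definition shift_average :: "nat \<Rightarrow> (int \<Rightarrow> complex) \<Rightarrow> (int \<Rightarrow> complex) \<Rightarrow> int \<Rightarrow> complex" where
  "shift_average d \<psi> b j = (\<Sum>k\<in>{0..<int d}. \<psi> k * b (j + k))"

lemma shift_average_ell2:
  assumes "b \<in> ell2 N"
  shows "shift_average d \<psi> b \<in> ell2 N"
proof -
  have "b (j + int (N\<^sup>2) + k) = b (j + k)" for j k
    using ell2_period[OF assms, of "j + k"] by (simp only: add_ac)
  then show ?thesis unfolding ell2_def shift_average_def by simp
qed

lemma zak_diff: "zak N (\<lambda>j. b j - c j) m n = zak N b m n - zak N c m n"
  by (simp add: zak_def left_diff_distrib sum_subtractf)

lemma zak_shift_average: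
  "zak N (shift_average d \<psi> b) m n = (\<Sum>k\<in>{0..<int d}. \<psi> k * zak N b (m + k) n)"
proof -
  have "zak N (shift_average d \<psi> b) m n
      = (\<Sum>j\<in>{0..<int N}. \<Sum>k\<in>{0..<int d}. \<psi> k * (b (m + k + j * int N) * echar N (- (j * n))))"
    by (simp add: zak_def shift_average_def sum_distrib_right mult.assoc add.assoc add.commute[of "j * int N" for j])
  then show ?thesis
    by (subst (asm) sum.swap) (simp add: zak_def sum_distrib_left)
qed

text \<open>\<open>w\<close> is a superposition of characters, and multiplication by the one of
  frequency \<open>k\<close> shifts the second Zak variable by \<open>k\<close> at the cost of a
  phase.\<close>

lemma zak_modulation:
  assumes N: "N > 0"
    and w: "\<And>j. w j = (\<Sum>k\<in>{0..<int (N\<^sup>2)}. \<psi> k * echar (N\<^sup>2) (j * k))"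
  shows "zak N (\<lambda>j. w j * b j) m n
    = (\<Sum>k\<in>{0..<int (N\<^sup>2)}. \<psi> k * (echar (N\<^sup>2) (m * k) * zak N b m (n - k)))"
proof -
  have e: "echar (N\<^sup>2) ((m + j * int N) * k) * echar N (- (j * n))
      = echar (N\<^sup>2) (m * k) * echar N (- (j * (n - k)))" for j k
  proof -
    have "echar (N\<^sup>2) ((m + j * int N) * k) = echar (N\<^sup>2) (m * k) * echar (N\<^sup>2) (int N * (j * k))"
      by (simp add: algebra_simps flip: echar_add)
    then show ?thesis
      by (simp only: echar_square[OF N] mult.assoc echar_add[symmetric]) (simp add: algebra_simps)
  qed
  have "zak N (\<lambda>j. w j * b j) m n = (\<Sum>j\<in>{0..<int N}. \<Sum>k\<in>{0..<int (N\<^sup>2)}.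
      \<psi> k * b (m + j * int N) * (echar (N\<^sup>2) ((m + j * int N) * k) * echar N (- (j * n))))"
    unfolding zak_def w sum_distrib_right by (intro sum.cong refl) (simp only: mult_ac)
  also have "\<dots> = (\<Sum>k\<in>{0..<int (N\<^sup>2)}. \<Sum>j\<in>{0..<int N}.
      \<psi> k * (echar (N\<^sup>2) (m * k) * (b (m + j * int N) * echar N (- (j * (n - k))))))"
    unfolding e by (subst sum.swap) (simp only: mult_ac)
  finally show ?thesis by (simp only: zak_def sum_distrib_left)
qed

text \<open>Translations become characters under the Fourier transform, so averaging against the
  kernel of \<open>w\<close> is the cutoff by \<open>w\<close> in frequency.\<close>

lemma fourier_shift_average:
  assumes b: "b \<in> ell2 N" and N: "N > 0"
  shows "finite_fourier N (shift_average (N\<^sup>2) \<psi> b) f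
    = (\<Sum>k\<in>{0..<int (N\<^sup>2)}. \<psi> k * echar (N\<^sup>2) (f * k)) * finite_fourier N b f"
proof -
  let ?d = "N\<^sup>2"
  have d: "?d > 0" using N by simp
  have shift: "(\<Sum>j\<in>{0..<int ?d}. b (j + k) * echar ?d (- (j * f)))
      = echar ?d (f * k) * (\<Sum>j\<in>{0..<int ?d}. b j * echar ?d (- (j * f)))" for k
  proof -
    let ?g = "\<lambda>j. b j * echar ?d (- (j * f))"
    have "?g (j + int ?d) = ?g j" for j
      using ell2_period[OF b, of j] echar_period[OF d, of "- (int ?d * f)" "- (j * f)"]
      by (simp add: ring_distribs)
    then have "(\<Sum>j\<in>{0..<int ?d}. ?g j) = (\<Sum>j\<in>{0..<int ?d}. ?g (j + k))"
      by (rule sum_periodic_shift[symmetric])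
    moreover have "echar ?d (f * k) * ?g (j + k) = b (j + k) * echar ?d (- (j * f))" for j
    proof -
      have "echar ?d (f * k) * echar ?d (- ((j + k) * f)) = echar ?d (- (j * f))"
        by (simp add: algebra_simps flip: echar_add)
      then show ?thesis by (simp only: mult.left_commute)
    qed
    ultimately show ?thesis by (simp only: sum_distrib_left)
  qed
  have "(\<Sum>j\<in>{0..<int ?d}. shift_average ?d \<psi> b j * echar ?d (- (j * f)))
      = (\<Sum>j\<in>{0..<int ?d}. \<Sum>k\<in>{0..<int ?d}. \<psi> k * (b (j + k) * echar ?d (- (j * f))))"
    by (simp only: shift_average_def sum_distrib_right mult.assoc)
  also have "\<dots> = (\<Sum>k\<in>{0..<int ?d}. \<psi> k * (\<Sum>j\<in>{0..<int ?d}. b (j + k) * echar ?d (- (j * f))))"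
    by (subst sum.swap) (simp only: sum_distrib_left)
  also have "\<dots> = (\<Sum>k\<in>{0..<int ?d}. \<psi> k * echar ?d (f * k)) * (\<Sum>j\<in>{0..<int ?d}. b j * echar ?d (- (j * f)))"
    by (simp only: shift sum_distrib_right mult.assoc)
  finally show ?thesis by (simp add: finite_fourier_echar)
qed

lemma finite_fourier_diff:
  "finite_fourier N (\<lambda>j. b j - c j) k = finite_fourier N b k - finite_fourier N c k"
  by (simp add: finite_fourier_echar left_diff_distrib sum_subtractf diff_divide_distrib)

text \<open>Reindexing moves the translation by \<open>s\<close> onto the kernel, so the jump costs
  only the variation of \<open>\<psi>\<close>.\<close>

lemma zak_shift_average_jump:
  assumes N: "N > 0" and b: "b \<in> ell2 N" and "B \<ge> 0"
    and bound: "\<And>m n. cmod (zak N b m n) \<le> B"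
    and \<psi>: "\<And>k. \<psi> (k + int (N\<^sup>2)) = \<psi> k"
    and jump: "(\<Sum>k\<in>{0..<int (N\<^sup>2)}. cmod (\<psi> (k + - s) - \<psi> k)) \<le> \<epsilon>"
  shows "cmod (zak N (shift_average (N\<^sup>2) \<psi> b) (m + s) n - zak N (shift_average (N\<^sup>2) \<psi> b) m n) \<le> \<epsilon> * B"
proof -
  let ?d = "N\<^sup>2"
  let ?f = "\<lambda>k. \<psi> (k + - s) * zak N b (m + k) n"
  have "?f (k + int ?d) = ?f k" for k
    using \<psi>[of "k + - s"] zak_period_1[OF b, of "m + k"] by (simp add: algebra_simps)
  then have "(\<Sum>k\<in>{0..<int ?d}. ?f (k + s)) = (\<Sum>k\<in>{0..<int ?d}. ?f k)"
    by (rule sum_periodic_shift)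
  then have "zak N (shift_average ?d \<psi> b) (m + s) n = (\<Sum>k\<in>{0..<int ?d}. ?f k)"
    by (simp add: zak_shift_average add_ac)
  then have "zak N (shift_average ?d \<psi> b) (m + s) n - zak N (shift_average ?d \<psi> b) m n
      = (\<Sum>k\<in>{0..<int ?d}. (\<psi> (k + - s) - \<psi> k) * zak N b (m + k) n)"
    by (simp only: zak_shift_average left_diff_distrib sum_subtractf)
  also have "cmod \<dots> \<le> (\<Sum>k\<in>{0..<int ?d}. cmod (\<psi> (k + - s) - \<psi> k) * B)"
    by (intro order.trans[OF norm_sum] sum_mono) (simp only: norm_mult, intro mult_left_mono bound norm_ge_zero)
  also have "\<dots> \<le> \<epsilon> * B"
    unfolding sum_distrib_right[symmetric] using jump \<open>B \<ge> 0\<close> by (rule mult_right_mono)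
  finally show ?thesis .
qed

text \<open>The twist by \<open>echar (N\<^sup>2) (m * t)\<close> gives both terms the common factor
  \<open>echar (N\<^sup>2) (m * (k + t)) * zak N b m (n - k)\<close> after reindexing; again only
  the kernel is differenced.\<close>

lemma zak_modulation_jump:
  assumes N: "N > 0" and "B \<ge> 0"
    and bound: "\<And>m n. cmod (zak N b m n) \<le> B"
    and \<psi>: "\<And>k. \<psi> (k + int (N\<^sup>2)) = \<psi> k"
    and w: "\<And>j. w j = (\<Sum>k\<in>{0..<int (N\<^sup>2)}. \<psi> k * echar (N\<^sup>2) (j * k))"
    and jump: "(\<Sum>k\<in>{0..<int (N\<^sup>2)}. cmod (\<psi> (k + t) - \<psi> k)) \<le> \<epsilon>"
  shows "cmod (zak N (\<lambda>j. w j * b j) m (n + t)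
      - echar (N\<^sup>2) (m * t) * zak N (\<lambda>j. w j * b j) m n) \<le> \<epsilon> * B"
proof -
  let ?d = "N\<^sup>2"
  have d: "?d > 0" using N by simp
  let ?f = "\<lambda>k. \<psi> k * (echar ?d (m * k) * zak N b m (n + t - k))"
  have "?f (k + int ?d) = ?f k" for k
  proof -
    have "echar ?d (m * (k + int ?d)) = echar ?d (m * k)"
      using echar_period[OF d, of "m * int ?d" "m * k"] by (simp only: distrib_left) simp
    moreover have "zak N b m (n + t - (k + int ?d)) = zak N b m (n + t - k)"
      using zak_period_2[OF N, of "- int ?d" b m "n + t - k"]
      by (simp add: power2_eq_square algebra_simps)
    ultimately show ?thesis by (simp only: \<psi>)
  qed
  then have "(\<Sum>k\<in>{0..<int ?d}. ?f k) = (\<Sum>k\<in>{0..<int ?d}. ?f (k + t))"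
    by (rule sum_periodic_shift[symmetric])
  also have "\<dots> = (\<Sum>k\<in>{0..<int ?d}. \<psi> (k + t) * (echar ?d (m * (k + t)) * zak N b m (n - k)))"
    by (intro sum.cong refl) simp
  finally have 1: "zak N (\<lambda>j. w j * b j) m (n + t)
      = (\<Sum>k\<in>{0..<int ?d}. \<psi> (k + t) * (echar ?d (m * (k + t)) * zak N b m (n - k)))"
    by (simp only: zak_modulation[OF N w])
  have 2: "echar ?d (m * t) * zak N (\<lambda>j. w j * b j) m n
      = (\<Sum>k\<in>{0..<int ?d}. \<psi> k * (echar ?d (m * (k + t)) * zak N b m (n - k)))"
    unfolding zak_modulation[OF N w] sum_distrib_left
    by (intro sum.cong refl) (simp add: distrib_left echar_add)
  have "zak N (\<lambda>j. w j * b j) m (n + t) - echar ?d (m * t) * zak N (\<lambda>j. w j * b j) m n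
      = (\<Sum>k\<in>{0..<int ?d}. (\<psi> (k + t) - \<psi> k) * (echar ?d (m * (k + t)) * zak N b m (n - k)))"
    by (simp only: 1 2 left_diff_distrib sum_subtractf)
  also have "cmod \<dots> \<le> (\<Sum>k\<in>{0..<int ?d}. cmod (\<psi> (k + t) - \<psi> k) * B)"
    by (intro order.trans[OF norm_sum] sum_mono)
      (simp only: norm_mult norm_echar mult_1_left, intro mult_left_mono bound norm_ge_zero)
  also have "\<dots> \<le> \<epsilon> * B"
    unfolding sum_distrib_right[symmetric] using jump \<open>B \<ge> 0\<close> by (rule mult_right_mono)
  finally show ?thesis .
qed

lemma sum_multiplier_le:
  fixes w a :: "int \<Rightarrow> complex"
  assumes "P \<le> d" and "\<And>j. cmod (1 - w j) \<le> 1" and "\<And>j. 0 \<le> j \<Longrightarrow> j < int P \<Longrightarrow> w j = 1"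
  shows "(\<Sum>j\<in>{0..<int d}. (cmod (a j - w j * a j))\<^sup>2) \<le> (\<Sum>j = P..<d. (cmod (a (int j)))\<^sup>2)"
proof -
  have "(cmod (a j - w j * a j))\<^sup>2 \<le> (if j < int P then 0 else (cmod (a j))\<^sup>2)" if "0 \<le> j" for j
  proof -
    have "a j - w j * a j = (1 - w j) * a j" by (simp add: algebra_simps)
    moreover have "(cmod (1 - w j) * cmod (a j))\<^sup>2 \<le> (cmod (a j))\<^sup>2"
      using assms(2)[of j] by (intro power_mono mult_left_le_one_le) auto
    ultimately show ?thesis using assms(3)[of j] that by (auto simp: norm_mult)
  qed
  then have "(\<Sum>j\<in>{0..<int d}. (cmod (a j - w j * a j))\<^sup>2)
      \<le> (\<Sum>j\<in>{0..<int d}. if j < int P then 0 else (cmod (a j))\<^sup>2)"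
    by (intro sum_mono) auto
  also have "\<dots> = (\<Sum>j\<in>{int P..<int d}. (cmod (a j))\<^sup>2)"
    using assms(1) by (intro sum.mono_neutral_cong_right) auto
  finally show ?thesis by (simp only: sum_nat_int[of "\<lambda>j. (cmod (a j))\<^sup>2"])
qed

section \<open>Gabor systems, and Riesz bounds as pointwise bounds on the Zak transform\<close>

lemma multiples_mod_eq:
  assumes "N > 0"
  shows "multiples_mod N = (\<lambda>p. int N * p) ` {0..<int N}"
proof -
  have "int N * k mod int (N\<^sup>2) = int N * (k mod int N)" for k
    by (simp only: power2_eq_square of_nat_mult mult_mod_right)
  then have "multiples_mod N = (\<lambda>p. int N * p) ` range (\<lambda>k. k mod int N)"
    by (auto simp: multiples_mod_def)
  also have "range (\<lambda>k. k mod int N) = {0..<int N}"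
  proof (intro subset_antisym subsetI)
    fix x assume "x \<in> {0..<int N}"
    then have "x = x mod int N" by simp
    then show "x \<in> range (\<lambda>k. k mod int N)" by (rule range_eqI)
  qed (use assms in auto)
  finally show ?thesis .
qed

text \<open>The modulation is constant along each coset of the multiples of \<open>N\<close>, and
  the translation is absorbed by iterated quasi-periodicity, so these time-frequency shifts act
  diagonally.\<close>

lemma zak_gabor:
  assumes N: "N > 0" and b: "b \<in> ell2 N"
  shows "zak N (gabor N b (int N * p, int N * q)) m n = echar N (q * m - p * n) * zak N b m n"
proof -
  let ?g = "gabor N b (int N * p, int N * q)"
  have g: "?g j = echar N (q * j) * b (j - int N * p)" for j
  proof -
    have "?g j = echar (N\<^sup>2) (int N * (q * j)) * b (j - int N * p)"
      by (simp add: gabor_def echar_def cis_conv_exp mult_ac)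
    then show ?thesis by (simp only: echar_square[OF N])
  qed
  \<comment> \<open>Both signs of \<open>r\<close> are covered because the translation uses
    \<open>- p\<close>.\<close>
  have qp: "zak N b (m' + int N * r) n = echar N (r * n) * zak N b m' n" for m' r
  proof (induction r rule: int_induct[where k = 0])
    case (step1 i)
    have "zak N b (m' + int N * (i + 1)) n = echar N n * zak N b (m' + int N * i) n"
      using zak_quasiperiod[OF N b, of "m' + int N * i" n] by (simp add: algebra_simps)
    then show ?case by (simp only: step1(2) distrib_right echar_add mult.assoc mult.left_commute mult_1_left)
  next
    case (step2 i)
    have "zak N b (m' + int N * i) n = echar N n * zak N b (m' + int N * (i - 1)) n"
      using zak_quasiperiod[OF N b, of "m' + int N * (i - 1)" n] by (simp add: algebra_simps)
    moreover have "echar N (i * n) = echar N n * echar N ((i - 1) * n)"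
      by (simp add: left_diff_distrib flip: echar_add)
    ultimately have "echar N n * zak N b (m' + int N * (i - 1)) n = echar N n * (echar N ((i - 1) * n) * zak N b m' n)"
      using step2(2) by (simp only: mult.assoc)
    then show ?case by (simp only: mult_left_cancel echar_nonzero not_False_eq_True)
  qed simp
  have "zak N ?g m n = echar N (q * m) * zak N b (m - int N * p) n"
    unfolding zak_def sum_distrib_left g
  proof (intro sum.cong refl)
    fix j
    have "echar N (q * (m + j * int N)) = echar N (q * m)"
      using echar_period[OF N, of "q * (j * int N)" "q * m"] by (simp only: distrib_left) simp
    then show "echar N (q * (m + j * int N)) * b (m + j * int N - int N * p) * echar N (- (j * n))
        = echar N (q * m) * (b (m - int N * p + j * int N) * echar N (- (j * n)))"
      by (simp add: algebra_simps)
  qed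
  then show ?thesis
    using qp[of m "- p"] by (simp add: echar_add diff_conv_add_uminus mult.assoc del: add_uminus_conv_diff)
qed

lemma sum_fun_apply: "(\<Sum>i\<in>S. f i) x = (\<Sum>i\<in>S. f i x)"
  by (induction S rule: infinite_finite_induct) auto

lemma zak_sum: "zak N (\<Sum>i\<in>S. f i) m n = (\<Sum>i\<in>S. zak N (f i) m n)"
  unfolding zak_def by (subst sum.swap) (simp add: sum_distrib_right sum_fun_apply)

lemma zak_scale_fun: "zak N (scale_fun c f) m n = c * zak N f m n"
  by (simp add: zak_def scale_fun_def sum_distrib_left mult.assoc)

lemma sum_gabor_index:
  assumes "N > 0"
  shows "(\<Sum>i\<in>gabor_index N. f i)
    = (\<Sum>p\<in>{0..<int N}. \<Sum>q\<in>{0..<int N}. f (int N * p, int N * q))"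
proof -
  have "gabor_index N = map_prod ((*) (int N)) ((*) (int N)) ` ({0..<int N} \<times> {0..<int N})"
    using assms by (simp add: gabor_index_def multiples_mod_eq map_prod_surj_on)
  moreover have "inj_on (map_prod ((*) (int N)) ((*) (int N))) ({0..<int N} \<times> {0..<int N})"
    using assms by (intro map_prod_inj_on) (auto simp: inj_on_def)
  ultimately show ?thesis
    by (simp add: sum.reindex sum.cartesian_product case_prod_unfold map_prod_def)
qed

lemma ell2_norm_zak:
  assumes "N > 0"
  shows "(ell2_norm N b)\<^sup>2
    = (\<Sum>m\<in>{0..<int N}. \<Sum>n\<in>{0..<int N}. (cmod (zak N b m n))\<^sup>2) / (real N)\<^sup>2"
proof -
  have "(ell2_norm N b)\<^sup>2 = 1 / real N * (\<Sum>j = 0..<N\<^sup>2. (cmod (b (int j)))\<^sup>2)"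
    by (simp add: ell2_norm_def sum_nonneg)
  also have "\<dots> = 1 / real N * (\<Sum>j\<in>{0..<int (N\<^sup>2)}. (cmod (b j))\<^sup>2)"
    by (simp add: sum_nat_int[of "\<lambda>j. (cmod (b j))\<^sup>2"])
  also have "\<dots> = real N * (\<Sum>j\<in>{0..<int (N\<^sup>2)}. (cmod (b j))\<^sup>2) / (real N)\<^sup>2"
    using assms by (simp add: power2_eq_square[of "real N"])
  finally show ?thesis by (simp only: sum_norm_zak[OF assms])
qed

lemma norm_zak_mod:
  assumes "N > 0" "b \<in> ell2 N"
  shows "cmod (zak N b (m mod int N) (n mod int N)) = cmod (zak N b m n)"
proof -
  have "cmod (zak N b m' (n mod int N)) = cmod (zak N b m' n)" for m'
    using periodic_shift[of "\<lambda>k. cmod (zak N b m' k)" "int N" "n mod int N" "n div int N"]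
      norm_zak_period[OF assms] by (simp add: mod_mult_div_eq)
  moreover have "cmod (zak N b (m mod int N) n') = cmod (zak N b m n')" for n'
    using periodic_shift[of "\<lambda>k. cmod (zak N b k n')" "int N" "m mod int N" "m div int N"]
      norm_zak_period[OF assms] by (simp add: mod_mult_div_eq)
  ultimately show ?thesis by simp
qed

text \<open>Testing the Riesz inequalities on the coefficients for which the Zak transform of the
  linear combination is supported at a single point.\<close>

lemma riesz_zak_bounds:
  assumes N: "N > 0" and b: "b \<in> ell2 N"
    and lower: "lower_riesz_ineq N (gabor_index N) (gabor N b) A"
    and upper: "upper_riesz_ineq N (gabor_index N) (gabor N b) B"
  shows "A \<le> (cmod (zak N b m n))\<^sup>2" and "(cmod (zak N b m n))\<^sup>2 \<le> B"
proof -
  define m0 where "m0 = m mod int N"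
  define n0 where "n0 = n mod int N"
  have mn: "m0 \<in> {0..<int N}" "n0 \<in> {0..<int N}" using N by (auto simp: m0_def n0_def)
  \<comment> \<open>The inverse double Fourier transform of a point mass at \<open>(m0, n0)\<close>;
    the \<open>N\<^sup>2\<close> coefficients each have modulus
    \<open>1 / N\<^sup>2\<close>.\<close>
  define c where "c = (\<lambda>(k, l). echar (N\<^sup>2) (k * n0 - l * m0) / of_nat (N\<^sup>2))"
  define S where "S = (\<Sum>i\<in>gabor_index N. scale_fun (c i) (gabor N b i))"
  have c_norm: "(\<Sum>i\<in>gabor_index N. (cmod (c i))\<^sup>2) = 1 / (real N)\<^sup>2"
    using N by (simp add: sum_gabor_index c_def norm_divide norm_power power_divide)
      (simp add: power2_eq_square power4_eq_xxxx)
  have zakS: "zak N S m' n' = (if m' = m0 \<and> n' = n0 then zak N b m0 n0 else 0)"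
    if "m' \<in> {0..<int N}" "n' \<in> {0..<int N}" for m' n'
  proof -
    have dvd: "int N dvd a - a' \<longleftrightarrow> a = a'" if "a \<in> {0..<int N}" "a' \<in> {0..<int N}" for a a'
      using that by (auto simp: mod_eq_dvd_iff[symmetric])
    have summand: "c (int N * p, int N * q) * zak N (gabor N b (int N * p, int N * q)) m' n'
        = zak N b m' n' / of_nat (N\<^sup>2) * (echar N ((n0 - n') * p) * echar N ((m' - m0) * q))" for p q
    proof -
      have "echar (N\<^sup>2) (int N * p * n0 - int N * q * m0) = echar N (p * n0 - q * m0)"
        using echar_square[OF N, of "p * n0 - q * m0"] by (simp add: right_diff_distrib mult.assoc)
      moreover have "echar N (p * n0 - q * m0) * echar N (q * m' - p * n')
          = echar N ((n0 - n') * p) * echar N ((m' - m0) * q)"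
        unfolding echar_add[symmetric] by (rule arg_cong[where f = "echar N"]) algebra
      ultimately show ?thesis
        by (simp add: c_def zak_gabor[OF N b] flip: mult.assoc)
    qed
    have "zak N S m' n' = (\<Sum>p\<in>{0..<int N}. \<Sum>q\<in>{0..<int N}.
        zak N b m' n' / of_nat (N\<^sup>2) * (echar N ((n0 - n') * p) * echar N ((m' - m0) * q)))"
      by (simp only: S_def zak_sum zak_scale_fun sum_gabor_index[OF N] summand)
    also have "\<dots> = zak N b m' n' / of_nat (N\<^sup>2)
        * ((\<Sum>p\<in>{0..<int N}. echar N ((n0 - n') * p)) * (\<Sum>q\<in>{0..<int N}. echar N ((m' - m0) * q)))"
      unfolding sum_product by (simp only: sum_distrib_left)
    also have "\<dots> = (if m' = m0 \<and> n' = n0 then zak N b m0 n0 else 0)"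
      using N dvd[OF that(1) mn(1)] dvd[OF mn(2) that(2)] by (auto simp: sum_echar power2_eq_square)
    finally show ?thesis .
  qed
  have "(\<Sum>m\<in>{0..<int N}. \<Sum>n\<in>{0..<int N}. (cmod (zak N S m n))\<^sup>2)
      = (\<Sum>m\<in>{0..<int N}. \<Sum>n\<in>{0..<int N}.
          if n = n0 then if m = m0 then (cmod (zak N b m0 n0))\<^sup>2 else 0 else 0)"
    by (intro sum.cong refl) (simp add: zakS)
  also have "\<dots> = (cmod (zak N b m0 n0))\<^sup>2"
    using mn by (simp del: atLeastLessThan_iff)
  also have "\<dots> = (cmod (zak N b m n))\<^sup>2"
    by (simp add: m0_def n0_def norm_zak_mod[OF N b])
  finally have S_norm: "(ell2_norm N S)\<^sup>2 = (cmod (zak N b m n))\<^sup>2 / (real N)\<^sup>2"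
    by (simp add: ell2_norm_zak[OF N])
  have "A * (1 / (real N)\<^sup>2) \<le> (cmod (zak N b m n))\<^sup>2 / (real N)\<^sup>2"
    using lower unfolding lower_riesz_ineq_def S_norm[symmetric] c_norm[symmetric] S_def by blast
  then show "A \<le> (cmod (zak N b m n))\<^sup>2" using N by (simp add: divide_le_cancel)
  have "(cmod (zak N b m n))\<^sup>2 / (real N)\<^sup>2 \<le> B * (1 / (real N)\<^sup>2)"
    using upper unfolding upper_riesz_ineq_def S_norm[symmetric] c_norm[symmetric] S_def by blast
  then show "(cmod (zak N b m n))\<^sup>2 \<le> B" using N by (simp add: divide_le_cancel)
qed

section \<open>Grids, averaging over translates and the final estimate\<close>

lemma uniform_grid:
  fixes \<rho> :: real
  assumes "0 < \<rho>" "\<rho> \<le> 1" and R: "1 \<le> R" "16 * real R \<le> N * \<rho>"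
  obtains g :: "nat \<Rightarrow> int" and K s :: nat
  where "g 0 = 0" "g K = int N" "\<And>i. 0 \<le> g (Suc i) - g i" "\<And>i. g (Suc i) - g i \<le> int s"
    "16 * (real R * s) \<le> N * \<rho>" "16 * s \<le> N" "real (Suc K) \<le> 96 * real R / \<rho>"
proof
  \<comment> \<open>The largest real step with \<open>16 * R * \<sigma> \<le> N * \<rho>\<close>. It
    is at least 1, so rounding down loses at most a factor 2.\<close>
  define \<sigma> where "\<sigma> = N * \<rho> / (16 * R)"
  define s where "s = nat \<lfloor>\<sigma>\<rfloor>"
  define K where "K = Suc (N div s)"
  \<comment> \<open>The truncation closes the grid exactly at \<open>N\<close>; beyond
    \<open>K\<close> it stays constant, so the step bounds hold for all \<open>i\<close>.\<close>
  define g where "g = (\<lambda>i. int (min (i * s) N))"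
  have \<sigma>: "1 \<le> \<sigma>" using R by (simp add: \<sigma>_def field_simps)
  then have s1: "1 \<le> s" by (simp add: s_def le_nat_iff)
  have "s = \<lfloor>\<sigma>\<rfloor>" using \<sigma> by (simp add: s_def)
  then have s: "s \<le> \<sigma>" "\<sigma> \<le> 2 * s" using s1 by linarith+
  show Rs: "16 * (real R * s) \<le> N * \<rho>" using s(1) R by (simp add: \<sigma>_def field_simps)
  have "real s \<le> real R * s" using R by (simp add: mult_le_cancel_right1)
  moreover have "N * \<rho> \<le> N" using \<open>\<rho> \<le> 1\<close> by (simp add: mult_left_le)
  ultimately have "real (16 * s) \<le> real N" using Rs by simp
  then show sN: "16 * s \<le> N" by linarith
  show "g 0 = 0" by (simp add: g_def)
  have "N < s * Suc (N div s)" using dividend_less_times_div[of s N] s1 by simp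
  then show "g K = int N" by (simp add: g_def K_def mult.commute)
  show "0 \<le> g (Suc i) - g i" "g (Suc i) - g i \<le> int s" for i
    by (auto simp: g_def)
  have "real (Suc K) \<le> N / s + 2"
    using of_nat_div_le_of_nat[of N s, where ?'a = real] by (simp add: K_def)
  \<comment> \<open>Here \<open>2 \<le> 2 * N / s\<close>; with \<open>s \<ge> \<sigma> / 2\<close>
    the count is at most \<open>6 * N / \<sigma>\<close>, hence the 96.\<close>
  also have "\<dots> \<le> 3 * (N / s)" using s1 sN by (simp add: field_simps)
  also have "\<dots> \<le> 3 * (N / (\<sigma> / 2))"
    using s \<sigma> by (intro mult_left_mono divide_left_mono) auto
  also have "\<dots> = 96 * real R / \<rho>"
    using R assms(1) \<sigma> by (cases "N = 0") (auto simp: \<sigma>_def field_simps)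
  finally show "real (Suc K) \<le> 96 * real R / \<rho>" .
qed

text \<open>Triangle inequality: each approximation error costs \<open>sqrt A / 25\<close> and the
  slow variation at most \<open>283 / 250 * sqrt A\<close>; the total factor
  \<open>303 / 250\<close> has square below \<open>3 / 2\<close>. The unimodular \<open>e\<close> is
  1 in the first variable and the twist in the second.\<close>

lemma jump_bound:
  assumes "0 < A" "A \<le> B"
    and z: "(cmod (z1 - a1))\<^sup>2 \<le> A / 625" "(cmod (z0 - a0))\<^sup>2 \<le> A / 625" and e: "cmod e = 1"
    and s: "16 * (real R * s) \<le> N * sqrt (A / B)" "\<bar>s'\<bar> \<le> s" and N: "0 < N"
    and a: "cmod (a1 - e * a0) \<le> 4 * sqrt 2 * pi * (N * R) * \<bar>s'\<bar> / (N\<^sup>2) * sqrt B"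
  shows "(cmod (z1 - e * z0))\<^sup>2 \<le> 3 / 2 * A"
proof -
  have sB: "sqrt (A / B) * sqrt B = sqrt A" using assms by (simp add: real_sqrt_divide)
  have "real R * \<bar>s'\<bar> \<le> real R * s" using s(2) by (intro mult_left_mono) auto
  then have "real R * \<bar>s'\<bar> / N \<le> sqrt (A / B) / 16" using s(1) N by (simp add: field_simps)
  then have "4 * (sqrt 2 * pi) * (real R * \<bar>s'\<bar> / N) * sqrt B \<le> 4 * (sqrt 2 * pi) * (sqrt (A / B) / 16) * sqrt B"
    using assms by (intro mult_right_mono mult_left_mono) auto
  also have "\<dots> = sqrt 2 * pi / 4 * sqrt A" using sB by simp
  also have "\<dots> \<le> 283 / 250 * sqrt A"
  proof (rule mult_right_mono)
    have "sqrt 2 \<le> 14143 / 10000" by (rule real_le_lsqrt) (auto simp: power2_eq_square)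
    then have "sqrt 2 * pi \<le> (14143 / 10000) * (16 / 5)" using pi_approx(2) by (intro mult_mono) auto
    then show "sqrt 2 * pi / 4 \<le> 283 / 250" by linarith
  qed (use assms in auto)
  finally have a': "cmod (a1 - e * a0) \<le> 283 / 250 * sqrt A"
    using a N by (simp add: power2_eq_square)
  have le: "cmod x \<le> sqrt A / 25" if "(cmod x)\<^sup>2 \<le> A / 625" for x
    using real_le_rsqrt[OF that] by (simp add: real_sqrt_divide)
  have "z1 - e * z0 = (z1 - a1) - e * (z0 - a0) + (a1 - e * a0)" by (simp add: algebra_simps)
  also have "cmod \<dots> \<le> cmod (z1 - a1) + cmod (e * (z0 - a0)) + cmod (a1 - e * a0)"
    by (meson add_mono norm_triangle_ineq norm_triangle_ineq4 order.trans order_refl)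
  also have "\<dots> \<le> sqrt A / 25 + sqrt A / 25 + 283 / 250 * sqrt A"
    unfolding norm_mult e using le[OF z(1)] le[OF z(2)] a' by simp
  also have "\<dots> = 303 / 250 * sqrt A" by simp
  finally have "(cmod (z1 - e * z0))\<^sup>2 \<le> (303 / 250 * sqrt A)\<^sup>2" by (intro power_mono) auto
  also have "\<dots> = 91809 / 62500 * A" using assms by (simp add: power_mult_distrib power2_eq_square)
  finally show ?thesis using assms by simp
qed

lemma sum_swap_pairs:
  fixes f :: "'a \<Rightarrow> 'b \<Rightarrow> 'c \<Rightarrow> 'd \<Rightarrow> 'e::comm_monoid_add"
  shows "(\<Sum>a\<in>A. \<Sum>b\<in>B. \<Sum>c\<in>C. \<Sum>d\<in>D. f a b c d)
    = (\<Sum>c\<in>C. \<Sum>d\<in>D. \<Sum>a\<in>A. \<Sum>b\<in>B. f a b c d)"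
proof -
  have "(\<Sum>a\<in>A. \<Sum>b\<in>B. \<Sum>c\<in>C. \<Sum>d\<in>D. f a b c d)
      = (\<Sum>a\<in>A. \<Sum>c\<in>C. \<Sum>d\<in>D. \<Sum>b\<in>B. f a b c d)"
    by (rule sum.cong[OF refl], subst sum.swap, rule sum.cong[OF refl], rule sum.swap)
  also have "\<dots> = (\<Sum>c\<in>C. \<Sum>d\<in>D. \<Sum>a\<in>A. \<Sum>b\<in>B. f a b c d)"
    by (subst sum.swap, rule sum.cong[OF refl], rule sum.swap)
  finally show ?thesis .
qed

text \<open>Every translate of the grid has a point with error at least \<open>A / 625\<close>,
  while the sum of the errors over all translates is the number of grid points times the total
  error, which the two tails control.\<close>

lemma zak_uncertainty:
  assumes N: "N > 0" and b: "b \<in> ell2 N" and A: "0 < A"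
    and bound: "\<And>m n. A \<le> (cmod (zak N b m n))\<^sup>2" "\<And>m n. (cmod (zak N b m n))\<^sup>2 \<le> B"
    and Q: "1 \<le> Q" "16 * real Q \<le> N * sqrt (A / B)"
    and R: "1 \<le> R" "16 * real R \<le> N * sqrt (A / B)"
  shows "A\<^sup>2 / (5760000 * B) / (real Q * real R) \<le> 1 / real N * (\<Sum>j = N * Q..<N\<^sup>2. (cmod (b (int j)))\<^sup>2)
    + 1 / real N * (\<Sum>k = N * R..<N\<^sup>2. (cmod (finite_fourier N b (int k)))\<^sup>2)" (is "_ \<le> ?T")
proof -
  define \<rho> where "\<rho> = sqrt (A / B)"
  have AB: "A \<le> B" using bound[of 0 0] by linarith
  have \<rho>: "0 < \<rho>" "\<rho> \<le> 1" using A AB by (auto simp: \<rho>_def)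
  \<comment> \<open>The cutoffs \<open>N * R\<close> and \<open>N * Q\<close> must not exceed half
    the period for \<open>smoothing_kernel\<close> to apply.\<close>
  have NR: "2 * M \<le> N" if "1 \<le> M" "16 * real M \<le> N * \<rho>" for M
  proof -
    have "N * \<rho> \<le> N" using \<rho> by (simp add: mult_left_le)
    then have "real (2 * M) \<le> real N" using that by simp
    then show ?thesis by linarith
  qed
  have NRd: "2 * (N * M) \<le> N\<^sup>2" if "2 * M \<le> N" for M
    using mult_le_mono2[OF that, of N] by (simp add: power2_eq_square mult_ac)
  note Q2 = NRd[OF NR[OF Q[folded \<rho>_def]]] and R2 = NRd[OF NR[OF R[folded \<rho>_def]]]
  obtain \<psi> w where \<psi>: "\<And>k. \<psi> (k + int (N\<^sup>2)) = \<psi> k"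
    and w: "\<And>j. w j = (\<Sum>k\<in>{0..<int (N\<^sup>2)}. \<psi> k * echar (N\<^sup>2) (j * k))"
      "\<And>j. cmod (1 - w j) \<le> 1" "\<And>j. 0 \<le> j \<Longrightarrow> j < int (N * R) \<Longrightarrow> w j = 1"
    and \<psi>_jump: "\<And>t. (\<Sum>k\<in>{0..<int (N\<^sup>2)}. cmod (\<psi> (k + t) - \<psi> k))
      \<le> 4 * sqrt 2 * pi * (N * R) * \<bar>of_int t\<bar> / (N\<^sup>2)"
    using smoothing_kernel[of "N * R" "N\<^sup>2"] N R R2 by auto
  obtain \<psi>' w' where \<psi>': "\<And>k. \<psi>' (k + int (N\<^sup>2)) = \<psi>' k"
    and w': "\<And>j. w' j = (\<Sum>k\<in>{0..<int (N\<^sup>2)}. \<psi>' k * echar (N\<^sup>2) (j * k))"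
      "\<And>j. cmod (1 - w' j) \<le> 1" "\<And>j. 0 \<le> j \<Longrightarrow> j < int (N * Q) \<Longrightarrow> w' j = 1"
    and \<psi>'_jump: "\<And>t. (\<Sum>k\<in>{0..<int (N\<^sup>2)}. cmod (\<psi>' (k + t) - \<psi>' k))
      \<le> 4 * sqrt 2 * pi * (N * Q) * \<bar>of_int t\<bar> / (N\<^sup>2)"
    using smoothing_kernel[of "N * Q" "N\<^sup>2"] N Q Q2 by auto
  define b1 where "b1 = shift_average (N\<^sup>2) \<psi> b"
  define b2 where "b2 = (\<lambda>j. w' j * b j)"
  define D1 where "D1 = (\<lambda>m n. (cmod (zak N b m n - zak N b1 m n))\<^sup>2)"
  define D2 where "D2 = (\<lambda>m n. (cmod (zak N b m n - zak N b2 m n))\<^sup>2)"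
  define D where "D = (\<lambda>m n. D1 m n + D2 m n)"
  have b1: "b1 \<in> ell2 N" unfolding b1_def using b by (rule shift_average_ell2)
  have b2: "b2 \<in> ell2 N"
  proof -
    have "w' (j + int (N\<^sup>2)) = w' j" for j
      unfolding w'(1)
    proof (intro sum.cong refl arg_cong2[where f = "(*)"])
      fix k show "echar (N\<^sup>2) ((j + int (N\<^sup>2)) * k) = echar (N\<^sup>2) (j * k)"
        using echar_period[of "N\<^sup>2" "int (N\<^sup>2) * k" "j * k"] N by (simp add: distrib_right)
    qed
    then show ?thesis using ell2_period[OF b] by (simp add: ell2_def b2_def)
  qed
  have diff_ell2: "(\<lambda>j. b j - c j) \<in> ell2 N" if "c \<in> ell2 N" for c
    using b that by (simp add: ell2_def)
  \<comment> \<open>The differences lie in \<open>ell2 N\<close>, so their Zak transforms are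
    quasi-periodic and the moduli periodic.\<close>
  have D_per: "D (m + int N) n = D m n" "D m (n + int N) = D m n" for m n
    unfolding D_def D1_def D2_def zak_diff[symmetric]
    by (simp_all only: norm_zak_period[OF N diff_ell2[OF b1]] norm_zak_period[OF N diff_ell2[OF b2]])
  have D_nonneg: "0 \<le> D1 m n" "0 \<le> D2 m n" for m n by (simp_all add: D1_def D2_def)

  \<comment> \<open>The Zak isometry and Plancherel turn the total first error into the Fourier
    tail; the second error needs only the isometry.\<close>
  have "(\<Sum>m\<in>{0..<int N}. \<Sum>n\<in>{0..<int N}. D1 m n)
      = real N * (\<Sum>j\<in>{0..<int (N\<^sup>2)}. (cmod (b j - b1 j))\<^sup>2)"
    unfolding D1_def zak_diff[symmetric] sum_norm_zak[OF N] ..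
  also have "\<dots> = real N * (\<Sum>k\<in>{0..<int (N\<^sup>2)}. (cmod (finite_fourier N (\<lambda>j. b j - b1 j) k))\<^sup>2)"
    by (simp only: plancherel_finite_fourier[OF N])
  also have "\<dots> = real N * (\<Sum>k\<in>{0..<int (N\<^sup>2)}. (cmod (finite_fourier N b k - w k * finite_fourier N b k))\<^sup>2)"
    by (simp only: finite_fourier_diff b1_def fourier_shift_average[OF b N] w(1))
  also have "\<dots> \<le> real N * (\<Sum>k = N * R..<N\<^sup>2. (cmod (finite_fourier N b (int k)))\<^sup>2)"
    using R2 w by (intro mult_left_mono sum_multiplier_le) auto
  finally have D1_le: "(\<Sum>m\<in>{0..<int N}. \<Sum>n\<in>{0..<int N}. D1 m n)
      \<le> real N * (\<Sum>k = N * R..<N\<^sup>2. (cmod (finite_fourier N b (int k)))\<^sup>2)" .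
  have "(\<Sum>m\<in>{0..<int N}. \<Sum>n\<in>{0..<int N}. D2 m n)
      = real N * (\<Sum>j\<in>{0..<int (N\<^sup>2)}. (cmod (b j - w' j * b j))\<^sup>2)"
    unfolding D2_def zak_diff[symmetric] sum_norm_zak[OF N] b2_def ..
  also have "\<dots> \<le> real N * (\<Sum>j = N * Q..<N\<^sup>2. (cmod (b (int j)))\<^sup>2)"
    using Q2 w' by (intro mult_left_mono sum_multiplier_le) auto
  finally have "(\<Sum>m\<in>{0..<int N}. \<Sum>n\<in>{0..<int N}. D m n)
      \<le> real N * (\<Sum>j = N * Q..<N\<^sup>2. (cmod (b (int j)))\<^sup>2)
        + real N * (\<Sum>k = N * R..<N\<^sup>2. (cmod (finite_fourier N b (int k)))\<^sup>2)"
    using D1_le by (simp add: D_def sum.distrib)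
  also have "\<dots> = (real N)\<^sup>2 * ?T" using N by (simp add: power2_eq_square field_simps)
  finally have D_le: "(\<Sum>m\<in>{0..<int N}. \<Sum>n\<in>{0..<int N}. D m n) \<le> (real N)\<^sup>2 * ?T" .

  \<comment> \<open>The step in the first variable is matched to the frequency cutoff
    \<open>R\<close>, that in the second to the time cutoff \<open>Q\<close>.\<close>
  obtain g K s where g: "g 0 = 0" "g K = int N" "\<And>i. 0 \<le> g (Suc i) - g i" "\<And>i. g (Suc i) - g i \<le> int s"
    and s: "16 * (real R * s) \<le> N * \<rho>" "16 * s \<le> N" and K: "real (Suc K) \<le> 96 * real R / \<rho>"
    using uniform_grid[OF \<rho> R[folded \<rho>_def]] by metis
  obtain g' L t where g': "g' 0 = 0" "g' L = int N" "\<And>i. 0 \<le> g' (Suc i) - g' i" "\<And>i. g' (Suc i) - g' i \<le> int t"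
    and t: "16 * (real Q * t) \<le> N * \<rho>" "16 * t \<le> N" and L: "real (Suc L) \<le> 96 * real Q / \<rho>"
    using uniform_grid[OF \<rho> Q[folded \<rho>_def]] by metis
  have zB: "cmod (zak N b m n) \<le> sqrt B" for m n
    using bound(2)[of m n] by (rule real_le_rsqrt)
  have B0: "0 \<le> sqrt B" using A AB by simp

  \<comment> \<open>Otherwise both approximations are good on the whole translated grid, and
    \<open>jump_bound\<close> makes every jump small enough for
    \<open>quasiperiodic_large_jump\<close>.\<close>
  have bad: "\<exists>i\<le>K. \<exists>j\<le>L. A / 625 \<le> D (x + g i) (y + g' j)" for x y
  proof (rule ccontr)
    assume "\<not> ?thesis"
    then have small: "D (x + g i) (y + g' j) \<le> A / 625" if "i \<le> K" "j \<le> L" for i j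
      using that by (meson linear)
    then have small: "D1 (x + g i) (y + g' j) \<le> A / 625" "D2 (x + g i) (y + g' j) \<le> A / 625"
      if "i \<le> K" "j \<le> L" for i j
      using small[OF that] D_nonneg[of "x + g i" "y + g' j"] unfolding D_def by linarith+
    show False
    proof (rule quasiperiodic_large_jump[of N A "zak N b" "\<lambda>i. x + g i" K "\<lambda>j. y + g' j" L])
      show "zak N b (m + int N) n = echar N n * zak N b m n" for m n
        using N b by (rule zak_quasiperiod)
      show "zak N b m (n + int N) = zak N b m n" for m n using N by (simp add: zak_period_2)
      show "0 \<le> x + g (Suc i) - (x + g i) \<and> 16 * (x + g (Suc i) - (x + g i)) \<le> int N" for i
        using g(3)[of i] g(4)[of i] zle_int[of "16 * s" N] s(2) by simp
      show "0 \<le> y + g' (Suc j) - (y + g' j) \<and> 16 * (y + g' (Suc j) - (y + g' j)) \<le> int N" for j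
        using g'(3)[of j] g'(4)[of j] zle_int[of "16 * t" N] t(2) by simp
      show "(cmod (zak N b (x + g (Suc i)) (y + g' j) - zak N b (x + g i) (y + g' j)))\<^sup>2 \<le> 3 / 2 * A"
        if "i < K" "j \<le> L" for i j
      proof -
        let ?s = "g (Suc i) - g i"
        have "cmod (zak N b1 (x + g i + ?s) (y + g' j) - zak N b1 (x + g i) (y + g' j))
            \<le> 4 * sqrt 2 * pi * (N * R) * \<bar>of_int (- ?s)\<bar> / (N\<^sup>2) * sqrt B"
          unfolding b1_def by (rule zak_shift_average_jump[OF N b B0 zB \<psi> \<psi>_jump])
        then have "cmod (zak N b1 (x + g (Suc i)) (y + g' j) - 1 * zak N b1 (x + g i) (y + g' j))
            \<le> 4 * sqrt 2 * pi * (N * R) * \<bar>of_int ?s\<bar> / (N\<^sup>2) * sqrt B"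
          by (simp add: abs_minus_commute)
        moreover have "\<bar>real_of_int ?s\<bar> \<le> s" using g(3,4)[of i] by linarith
        ultimately have "(cmod (zak N b (x + g (Suc i)) (y + g' j) - 1 * zak N b (x + g i) (y + g' j)))\<^sup>2 \<le> 3 / 2 * A"
          using jump_bound[OF A AB, of _ "zak N b1 (x + g (Suc i)) (y + g' j)" _ "zak N b1 (x + g i) (y + g' j)" 1 R s N "of_int ?s"]
            small(1)[of "Suc i" j] small(1)[of i j] that s(1) N by (simp add: D1_def \<rho>_def)
        then show ?thesis by simp
      qed
      show "(cmod (zak N b (x + g i) (y + g' (Suc j)) - echar (N\<^sup>2) ((x + g i) * (y + g' (Suc j) - (y + g' j)))
          * zak N b (x + g i) (y + g' j)))\<^sup>2 \<le> 3 / 2 * A" if "i \<le> K" "j < L" for i j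
      proof -
        let ?t = "g' (Suc j) - g' j"
        have "cmod (zak N b2 (x + g i) (y + g' j + ?t) - echar (N\<^sup>2) ((x + g i) * ?t) * zak N b2 (x + g i) (y + g' j))
            \<le> 4 * sqrt 2 * pi * (N * Q) * \<bar>of_int ?t\<bar> / (N\<^sup>2) * sqrt B"
          unfolding b2_def by (rule zak_modulation_jump[OF N B0 zB \<psi>' w'(1) \<psi>'_jump])
        then have "cmod (zak N b2 (x + g i) (y + g' (Suc j)) - echar (N\<^sup>2) ((x + g i) * ?t) * zak N b2 (x + g i) (y + g' j))
            \<le> 4 * sqrt 2 * pi * (N * Q) * \<bar>of_int ?t\<bar> / (N\<^sup>2) * sqrt B"
          by simp
        moreover have "\<bar>real_of_int ?t\<bar> \<le> t" using g'(3,4)[of j] by linarith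
        ultimately show ?thesis
          using jump_bound[OF A AB, of _ "zak N b2 (x + g i) (y + g' (Suc j))" _ "zak N b2 (x + g i) (y + g' j)"
              "echar (N\<^sup>2) ((x + g i) * ?t)" Q t N "of_int ?t"]
            small(2)[of i "Suc j"] small(2)[of i j] that t(1) N by (simp add: D2_def \<rho>_def)
      qed
    qed (use N A bound g g' in auto)
  qed

  have "(real N)\<^sup>2 * (A / 625) = (\<Sum>x\<in>{0..<int N}. \<Sum>y\<in>{0..<int N}. A / 625)"
    by (simp add: power2_eq_square)
  also have "\<dots> \<le> (\<Sum>x\<in>{0..<int N}. \<Sum>y\<in>{0..<int N}. \<Sum>i\<le>K. \<Sum>j\<le>L. D (x + g i) (y + g' j))"
  proof (intro sum_mono)
    fix x y
    obtain i j where ij: "i \<le> K" "j \<le> L" "A / 625 \<le> D (x + g i) (y + g' j)" using bad by blast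
    have nonneg: "0 \<le> D m n" for m n using D_nonneg[of m n] by (simp add: D_def)
    have "D (x + g i) (y + g' j) \<le> (\<Sum>j\<le>L. D (x + g i) (y + g' j))"
      using ij nonneg by (intro member_le_sum) auto
    also have "\<dots> \<le> (\<Sum>i\<le>K. \<Sum>j\<le>L. D (x + g i) (y + g' j))"
      using ij nonneg by (intro member_le_sum[where f = "\<lambda>i. \<Sum>j\<le>L. D (x + g i) (y + g' j)"] sum_nonneg) auto
    finally show "A / 625 \<le> (\<Sum>i\<le>K. \<Sum>j\<le>L. D (x + g i) (y + g' j))" using ij by linarith
  qed
  also have "\<dots> = (\<Sum>i\<le>K. \<Sum>j\<le>L. \<Sum>x\<in>{0..<int N}. \<Sum>y\<in>{0..<int N}. D (x + g i) (y + g' j))"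
    by (rule sum_swap_pairs)
  \<comment> \<open>By periodicity the sum over all translates is the same for every grid
    point.\<close>
  also have "\<dots> = (\<Sum>i\<le>K. \<Sum>j\<le>L. \<Sum>x\<in>{0..<int N}. \<Sum>y\<in>{0..<int N}. D x y)"
  proof (rule sum.cong[OF refl], rule sum.cong[OF refl])
    fix i j
    have "(\<Sum>x\<in>{0..<int N}. \<Sum>y\<in>{0..<int N}. D (x + g i) (y + g' j))
        = (\<Sum>x\<in>{0..<int N}. \<Sum>y\<in>{0..<int N}. D (x + g i) y)"
      by (intro sum.cong refl sum_periodic_shift D_per)
    also have "\<dots> = (\<Sum>x\<in>{0..<int N}. \<Sum>y\<in>{0..<int N}. D x y)"
      by (rule sum_periodic_shift[of "\<lambda>x. \<Sum>y\<in>{0..<int N}. D x y"]) (simp only: D_per)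
    finally show "(\<Sum>x\<in>{0..<int N}. \<Sum>y\<in>{0..<int N}. D (x + g i) (y + g' j))
        = (\<Sum>x\<in>{0..<int N}. \<Sum>y\<in>{0..<int N}. D x y)" .
  qed
  also have "\<dots> = (real (Suc K) * real (Suc L)) * (\<Sum>x\<in>{0..<int N}. \<Sum>y\<in>{0..<int N}. D x y)"
    by (simp only: sum_constant card_atMost mult.assoc)
  also have "\<dots> \<le> (real (Suc K) * real (Suc L)) * ((real N)\<^sup>2 * ?T)"
    using D_le by (rule mult_left_mono) simp
  also have "\<dots> \<le> (96 * real R / \<rho> * (96 * real Q / \<rho>)) * ((real N)\<^sup>2 * ?T)"
    using K L \<rho> by (intro mult_right_mono mult_mono) (auto intro!: mult_nonneg_nonneg add_nonneg_nonneg divide_nonneg_nonneg sum_nonneg)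
  also have "\<dots> = (real N)\<^sup>2 * (9216 * real R * real Q / \<rho>\<^sup>2 * ?T)"
    by (simp add: power2_eq_square)
  finally have T: "A / 625 \<le> 9216 * real R * real Q / \<rho>\<^sup>2 * ?T"
    by (rule mult_left_le_imp_le) (use N in simp)
  \<comment> \<open>Stated for arbitrary \<open>c\<close> and \<open>T\<close> so that the sums stay
    opaque while the inequality is solved.\<close>
  have "A / 625 * \<rho>\<^sup>2 / c \<le> T" if "A / 625 \<le> c / \<rho>\<^sup>2 * T" "0 < c" for c T
    using that \<rho> by (simp add: field_simps)
  from this[OF T] have "A / 625 * \<rho>\<^sup>2 / (9216 * real R * real Q) \<le> ?T"
    using Q R by simp
  moreover have "\<rho>\<^sup>2 = A / B" using A AB by (simp add: \<rho>_def)
  then have "A / 625 * \<rho>\<^sup>2 / (9216 * real R * real Q) = A\<^sup>2 / (5760000 * B) / (real Q * real R)"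
    by (simp add: power2_eq_square)
  ultimately show ?thesis by simp
qed

theorem theorem5p3:
  fixes A B :: real
  assumes "A > 0" and "B > 0"
  shows "\<exists>C>0. \<forall>(N::nat) (b::int \<Rightarrow> complex).
    real N \<ge> 200 * sqrt (B / A) \<longrightarrow>
    b \<in> ell2 N \<longrightarrow>
    is_basis N (gabor_index N) (gabor N b) \<longrightarrow>
    has_riesz_bounds N (gabor_index N) (gabor N b) A B \<longrightarrow>
    (\<forall>(Q::nat) (R::nat).
      1 \<le> Q \<longrightarrow> real Q \<le> (real N / 16) * sqrt (A / B) \<longrightarrow>
      1 \<le> R \<longrightarrow> real R \<le> (real N / 16) * sqrt (A / B) \<longrightarrow>
      (1 / real N) * (\<Sum>j = N * Q..N\<^sup>2 - 1. (cmod (b (int j)))\<^sup>2)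
      + (1 / real N) * (\<Sum>k = N * R..N\<^sup>2 - 1. (cmod (finite_fourier N b (int k)))\<^sup>2)
      \<ge> C / (real Q * real R))"
\<comment> \<open>\<open>5760000 = 625 * 96\<^sup>2\<close>: the error threshold times the two grid
  counts. The remaining factor \<open>A / B\<close> is \<open>\<rho>\<^sup>2\<close>.\<close>
proof (intro exI[of _ "A\<^sup>2 / (5760000 * B)"] conjI allI impI)
  show "0 < A\<^sup>2 / (5760000 * B)" using assms by simp
next
  fix N :: nat and b :: "int \<Rightarrow> complex" and Q R :: nat
  assume N: "real N \<ge> 200 * sqrt (B / A)" and b: "b \<in> ell2 N"
    and riesz: "has_riesz_bounds N (gabor_index N) (gabor N b) A B"
    and QR: "1 \<le> Q" "real Q \<le> (real N / 16) * sqrt (A / B)" "1 \<le> R" "real R \<le> (real N / 16) * sqrt (A / B)"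
  from riesz have lower: "lower_riesz_ineq N (gabor_index N) (gabor N b) A"
    and upper: "upper_riesz_ineq N (gabor_index N) (gabor N b) B"
    by (simp_all add: has_riesz_bounds_def)
  \<comment> \<open>Positivity of \<open>N\<close> makes \<open>N\<^sup>2 - 1\<close> a true
    predecessor in the naturals, so closed and half-open ranges agree.\<close>
  have "0 < 200 * sqrt (B / A)" using assms by simp
  then have N0: "N > 0" using N by linarith
  then have "0 < N\<^sup>2" by simp
  then have "x \<in> {a..N\<^sup>2 - 1} \<longleftrightarrow> x \<in> {a..<N\<^sup>2}" for a x
    unfolding atLeastAtMost_iff atLeastLessThan_iff by arith
  then have "{a..N\<^sup>2 - 1} = {a..<N\<^sup>2}" for a by blast
  moreover note zak_uncertainty[OF N0 b assms(1) riesz_zak_bounds[OF N0 b lower upper], of Q R]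
  ultimately show "A\<^sup>2 / (5760000 * B) / (real Q * real R)
      \<le> (1 / real N) * (\<Sum>j = N * Q..N\<^sup>2 - 1. (cmod (b (int j)))\<^sup>2)
      + (1 / real N) * (\<Sum>k = N * R..N\<^sup>2 - 1. (cmod (finite_fourier N b (int k)))\<^sup>2)"
    using QR by simp
qed

end
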